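(* Let $K\ge 1$, $J\ge 0$, $\tilde K=K+J$, and let $M_j,d_j$ ($1\le j\le\tilde K$) and $N_k$ ($1\le k\le K$) be positive integers. For $k\in\{1,\dots,K\}$ and $j\in\{1,\dots,\tilde K\}$ let $\mathbf H_{kj}\in\mathbb C^{N_k\times M_j}$ be random matrices, all of whose entries (over all $k,j$) are independent random variables drawn from continuous distributions. Let $\mathcal A$ be any alignment set generated by the Feasible Alignment Set algorithm (described in the context). Then, almost surely, there exist matrices $\mathbf U_k\in\mathbb C^{N_k\times d_k}$ ($1\le k\le K$) and $\mathbf V_j\in\mathbb C^{M_j\times d_j}$ ($1\le j\le\tilde K$) such that $$\mathrm{rank}(\mathbf U_k^{\mathrm H}\mathbf H_{kk}\mathbf V_k)=d_k\ \ (1\le k\le K),\qquad \mathrm{rank}(\mathbf V_j)=d_j\ \ (K+1\le j\le\tilde K),$$ $$\mathbf U_k^{\mathrm H}\mathbf H_{kj}\mathbf V_j=\mathbf 0\quad\text{for all }(k,j)\in\mathcal A .$$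
   Context: $(\cdot)^{\mathrm H}$ denotes the Hermitian (conjugate) transpose. The indices $1,\dots,K$ label legitimate transmitter/receiver pairs and $K+1,\dots,K+J$ label legitimate jammers; transmitter or jammer $j$ has $M_j$ antennas and sends $d_j$ streams, receiver $k$ has $N_k$ antennas. "Drawn from a continuous distribution" means that the distribution has no atoms (e.g. it has a density). Feasible Alignment Set algorithm. (1) Transmitter side: each transmitter or jammer $j\in\{1,\dots,\tilde K\}$ selects (by an arbitrary criterion) a set of receivers, i.e. a set $\mathcal A^{(t)}(j)\subseteq(\{1,\dots,K\}\setminus\{j\})\times\{j\}$, such that $\sum_{k:(k,j)\in\mathcal A^{(t)}(j)}d_k\le M_j-d_j$. (2) Receiver side: each receiver $k\in\{1,\dots,K\}$ selects (by an arbitrary criterion) among the transmitters and jammers $j\neq k$ which did not select receiver $k$ in step (1), i.e. it chooses a set $\mathcal A^{(r)}(k)\subseteq\{(k,j): j\in\{1,\dots,\tilde K\}\setminus\{k\},\ (k,j)\notin\mathcal A^{(t)}(j)\}$, such that $\sum_{j:(k,j)\in\mathcal A^{(r)}(k)}d_j\le N_k-d_k$. (3) Output $\mathcal A=\big(\bigcup_{k=1}^{K}\mathcal A^{(r)}(k)\big)\cup\big(\bigcup_{j=1}^{\tilde K}\mathcal A^{(t)}(j)\big)$. Empty sums equal $0$, so the constraints entail $d_j\le M_j$ and $d_k\le N_k$. *)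

theory Defs
  imports
    "HOL-Probability.Probability"
    "Jordan_Normal_Form.DL_Rank"
    "Jordan_Normal_Form.Schur_Decomposition"
begin

(* At j and Ar k are the choices of transmitter or jammer j and of receiver k; every pair is
   (receiver, transmitter).  The budgets M j - d j and N k - d k are integers in the source and
   entail d j <= M j and d k <= N k; d is therefore added on the left, because subtraction on nat
   would truncate. *)
definition feasible_alignment_set ::
  "nat \<Rightarrow> nat \<Rightarrow> (nat \<Rightarrow> nat) \<Rightarrow> (nat \<Rightarrow> nat) \<Rightarrow> (nat \<Rightarrow> nat) \<Rightarrow> (nat \<times> nat) set \<Rightarrow> bool"
where
  "feasible_alignment_set K J M N d \<A> \<longleftrightarrow>
    (\<exists>At Ar :: nat \<Rightarrow> (nat \<times> nat) set.
      (\<forall>j\<in>{1..K+J}. At j \<subseteq> ({1..K} - {j}) \<times> {j} \<and>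
         (\<Sum>k | (k, j) \<in> At j. d k) + d j \<le> M j) \<and>
      (\<forall>k\<in>{1..K}. Ar k \<subseteq> {(k, j) | j. j \<in> {1..K+J} - {k} \<and> (k, j) \<notin> At j} \<and>
         (\<Sum>j | (k, j) \<in> Ar k. d j) + d k \<le> N k) \<and>
      \<A> = (\<Union>k\<in>{1..K}. Ar k) \<union> (\<Union>j\<in>{1..K+J}. At j))"

(* Atomless only: no density is required. *)
definition continuously_distributed :: "'a measure \<Rightarrow> ('a \<Rightarrow> complex) \<Rightarrow> bool" where
  "continuously_distributed P X \<longleftrightarrow>
    X \<in> borel_measurable P \<and> (\<forall>z. emeasure (distr P borel X) {z} = 0)"

(* The entries of matrices are indexed from 0. *)
definition entry_indices ::
  "nat \<Rightarrow> nat \<Rightarrow> (nat \<Rightarrow> nat) \<Rightarrow> (nat \<Rightarrow> nat) \<Rightarrow> (nat \<times> nat \<times> nat \<times> nat) set"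
where
  "entry_indices K J M N =
    {(k, j, a, b). k \<in> {1..K} \<and> j \<in> {1..K+J} \<and> a < N k \<and> b < M j}"

end

(*
  The unknowns are W_k = U_k^H and V_j, so the equations are polynomial over the integers in the
  entries of W, H and V.  Almost surely the entries of H are algebraically independent over the
  rationals, because a nonzero polynomial vanishes with probability zero at independent atomless
  variables.  Two algebraically independent tuples g and h of the same size are conjugate: g -> h
  extends to an isomorphism between the countable subfields that they generate, and further to any
  finitely many complex numbers.  Such an isomorphism carries a solution for the channel g to a
  solution for the channel h, so one algebraically independent channel with a solution is enough.
  To find one, normalise W_k = [I *] and V_j = [I ; *].  By the budget inequalities the equation for
  each pair of streams can be given an unknown entry of its own, and for a suitable 0-1 channel the
  equations just say that these entries vanish.  For all nearby channels the equations
  are a contraction, hence solvable, and algebraically independent tuples are dense.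
*)

theory Submission
  imports Defs
begin

section \<open>Algebraically independent tuples\<close>

text \<open>Syntax trees for polynomials with integer coefficients. Several trees may denote one
  polynomial, which is harmless. What counts is that countably many variables give only countably
  many trees, so that a property holding almost surely for each tree holds almost surely for all of
  them.\<close>

datatype 'v pexp = Var 'v | Cst int | Add "'v pexp" "'v pexp" | Mul "'v pexp" "'v pexp"

instance pexp :: (countable) countable
  by countable_datatype

primrec peval :: "'v pexp \<Rightarrow> ('v \<Rightarrow> complex) \<Rightarrow> complex" where
  "peval (Var i) x = x i"
| "peval (Cst c) x = of_int c"
| "peval (Add e f) x = peval e x + peval f x"
| "peval (Mul e f) x = peval e x * peval f x"

(* Indices outside I are evaluated at 0, so that only the variables in I matter. *)
definition alg_indep :: "'v set \<Rightarrow> ('v \<Rightarrow> complex) \<Rightarrow> bool" where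
  "alg_indep I x \<longleftrightarrow>
    (\<forall>e. peval e (override_on (\<lambda>_. 0) x I) = 0 \<longrightarrow> (\<forall>y. peval e (override_on (\<lambda>_. 0) y I) = 0))"

text \<open>Freezing all variables but one reduces zero sets in several variables to the finitely
  many roots of a nonzero complex polynomial.\<close>

lemma peval_univariate: "\<exists>p. \<forall>y. peval e (x(i := y)) = poly p y"
proof (induction e)
  case (Var j)
  have "\<forall>y. peval (Var j) (x(i := y)) = poly (if j = i then [:0, 1:] else [:x j:]) y"
    by auto
  then show ?case by blast
next
  case (Cst c)
  have "\<forall>y. peval (Cst c) (x(i := y)) = poly [:of_int c:] y"
    by auto
  then show ?case by blast
next
  case (Add e f)
  then show ?case by (metis peval.simps(3) poly_add)
next
  case (Mul e f)
  then show ?case by (metis peval.simps(4) poly_mult)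
qed

lemma borel_measurable_peval:
  assumes "\<And>i. i \<in> I \<Longrightarrow> sets (M i) = sets borel"
  shows "(\<lambda>x. peval e (override_on c x I)) \<in> borel_measurable (PiM I M)"
proof (induction e)
  case (Var j)
  show ?case
  proof (cases "j \<in> I")
    case True
    then have "(\<lambda>x. x j) \<in> measurable (PiM I M) (M j)"
      by (rule measurable_component_singleton)
    then have "(\<lambda>x. x j) \<in> borel_measurable (PiM I M)"
      using assms[OF True] measurable_cong_sets by blast
    then show ?thesis using True by (simp add: override_on_def)
  qed (simp add: override_on_def)
qed simp_all

lemma AE_peval_nonzero:
  fixes M :: "'v \<Rightarrow> complex measure"
  assumes "finite I"
    and prob: "\<And>i. prob_space (M i)"
    and borel: "\<And>i. sets (M i) = sets borel"
    and atomless: "\<And>i z. emeasure (M i) {z} = 0"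
    and "peval e (override_on c x I) \<noteq> 0"
  shows "AE y in PiM I M. peval e (override_on c y I) \<noteq> 0"
  using assms(1,5)
proof (induction I arbitrary: c rule: finite_induct)
  case empty
  then show ?case by simp
next
  case (insert i I)
  interpret product_prob_space M
    using prob by (simp add: product_prob_space_def product_prob_space_axioms_def
        product_sigma_finite_def prob_space_imp_sigma_finite)
  let ?c = "c(i := x i)"
  have upd: "override_on ?c y I = (override_on c y I)(i := x i)" for y
    using insert.hyps by (auto simp: override_on_def)
  have upd': "override_on c (y(i := z)) (insert i I) = (override_on c y I)(i := z)" for y z
    using insert.hyps by (auto simp: override_on_def)
  have "peval e (override_on ?c x I) \<noteq> 0"
    using insert.prems by (metis fun_upd_triv upd upd')
  then have IH: "AE y in PiM I M. peval e (override_on ?c y I) \<noteq> 0"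
    by (rule insert.IH)
  \<comment> \<open>The zero set enters Fubini through its indicator; the vanishing integral is
    turned back into an almost sure statement at the end.\<close>
  let ?f = "\<lambda>y. indicator {0} (peval e (override_on c y (insert i I))) :: ennreal"
  have meas: "(\<lambda>y. peval e (override_on c y (insert i I))) \<in> borel_measurable (PiM (insert i I) M)"
    by (rule borel_measurable_peval) (simp add: borel)
  have measf: "?f \<in> borel_measurable (PiM (insert i I) M)"
    using meas by measurable
  have inner: "(\<integral>\<^sup>+ z. ?f (y(i := z)) \<partial>M i) = 0" if "peval e (override_on ?c y I) \<noteq> 0" for y
  proof -
    obtain p where p: "\<And>z. peval e ((override_on c y I)(i := z)) = poly p z"
      using peval_univariate[of e "override_on c y I" i] by blast
    have "p \<noteq> 0" using that p[of "x i"] upd by auto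
    then have fin: "finite {z. poly p z = 0}" by (rule poly_roots_finite)
    have "(\<Union>z\<in>{z. poly p z = 0}. {z}) \<in> null_sets (M i)"
      by (rule null_sets_UN') (use fin atomless borel in \<open>auto intro!: null_setsI simp: countable_finite\<close>)
    then have "AE z in M i. z \<notin> {z. poly p z = 0}"
      by (intro AE_not_in) simp
    then have "AE z in M i. ?f (y(i := z)) = 0"
      by eventually_elim (simp add: upd' p)
    then have "(\<integral>\<^sup>+ z. ?f (y(i := z)) \<partial>M i) = (\<integral>\<^sup>+ z. 0 \<partial>M i)"
      by (rule nn_integral_cong_AE)
    then show ?thesis by simp
  qed
  have "(\<integral>\<^sup>+ y. ?f y \<partial>PiM (insert i I) M) = (\<integral>\<^sup>+ y. (\<integral>\<^sup>+ z. ?f (y(i := z)) \<partial>M i) \<partial>PiM I M)"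
    by (rule product_nn_integral_insert[OF insert.hyps measf])
  also have "\<dots> = (\<integral>\<^sup>+ y. 0 \<partial>PiM I M)"
    by (rule nn_integral_cong_AE, use IH in eventually_elim) (rule inner)
  finally have "AE y in PiM (insert i I) M. ?f y = 0"
    using measf by (simp add: nn_integral_0_iff_AE)
  then show ?case
    by eventually_elim (auto simp: indicator_def)
qed

text \<open>Each of the countably many expressions that do not vanish identically vanishes only on a
  null set, and the union of these sets is null.\<close>

lemma AE_alg_indep:
  fixes M :: "'v::countable \<Rightarrow> complex measure"
  assumes "finite I"
    and prob: "\<And>i. i \<in> I \<Longrightarrow> prob_space (M i)"
    and borel: "\<And>i. i \<in> I \<Longrightarrow> sets (M i) = sets borel"
    and atomless: "\<And>i z. i \<in> I \<Longrightarrow> emeasure (M i) {z} = 0"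
  shows "AE x in PiM I M. alg_indep I x"
proof (cases "I = {}")
  case True
  then show ?thesis by (simp add: alg_indep_def)
next
  case False
  then obtain i0 where i0: "i0 \<in> I" by blast
  \<comment> \<open>\<open>AE_peval_nonzero\<close> expects an atomless probability measure at every
    index, so the indices outside \<open>I\<close> borrow that of \<open>i0\<close>.\<close>
  define M' where "M' i = (if i \<in> I then M i else M i0)" for i
  have eq: "PiM I M = PiM I M'"
    by (rule PiM_cong) (simp_all add: M'_def)
  have "AE x in PiM I M'. peval e (override_on (\<lambda>_. 0) x I) = 0 \<longrightarrow>
      (\<forall>y. peval e (override_on (\<lambda>_. 0) y I) = 0)" for e
  proof (cases "\<forall>y. peval e (override_on (\<lambda>_. 0) y I) = 0")
    case False
    then obtain y where "peval e (override_on (\<lambda>_. 0) y I) \<noteq> 0" by blast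
    then have "AE x in PiM I M'. peval e (override_on (\<lambda>_. 0) x I) \<noteq> 0"
      using i0 by (intro AE_peval_nonzero[OF assms(1)]) (auto simp: M'_def prob borel atomless)
    then show ?thesis by eventually_elim simp
  qed simp
  then show ?thesis
    unfolding alg_indep_def eq by (subst AE_all_countable) blast
qed

text \<open>Uniform distributions on the balls of radius \<epsilon> around the \<open>c i\<close>
  are atomless. Under their product almost every tuple is algebraically independent and close to
  \<open>c\<close>, and a probability measure leaves room for at least one.\<close>

lemma alg_indep_dense:
  fixes c :: "'v::countable \<Rightarrow> complex"
  assumes "finite I" "\<epsilon> > 0"
  obtains x where "alg_indep I x" "\<And>i. i \<in> I \<Longrightarrow> dist (c i) (x i) < \<epsilon>"
proof -
  define M where "M i = uniform_measure lborel (ball (c i) \<epsilon>)" for i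
  have pos: "emeasure lborel (ball (c i) \<epsilon>) \<noteq> 0" for i
  proof
    assume "emeasure lborel (ball (c i) \<epsilon>) = 0"
    then have "ball (c i) \<epsilon> \<in> null_sets lborel"
      by (intro null_setsI) auto
    then have "negligible (ball (c i) \<epsilon>)"
      by (simp add: negligible_iff_null_sets null_sets_completionI)
    then show False
      using open_not_negligible[of "ball (c i) \<epsilon>"] assms(2) by simp
  qed
  have fin: "emeasure lborel (ball (c i) \<epsilon>) \<noteq> \<infinity>" for i
    using emeasure_bounded_finite[of "ball (c i) \<epsilon>"] by simp
  have prob: "prob_space (M i)" for i
    unfolding M_def by (rule prob_space_uniform_measure[OF pos fin])
  have borel: "sets (M i) = sets borel" for i
    by (simp add: M_def)
  have "emeasure (M i) {z} = 0" for i z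
    unfolding M_def by (subst emeasure_uniform_measure) (auto simp: Int_insert_right)
  then have "AE x in PiM I M. alg_indep I x"
    by (intro AE_alg_indep assms(1) prob borel)
  moreover have "AE x in PiM I M. \<forall>i\<in>I. x i \<in> ball (c i) \<epsilon>"
  proof (rule AE_finite_allI[OF assms(1)])
    fix i assume "i \<in> I"
    have "AE z in M i. z \<in> ball (c i) \<epsilon>"
      unfolding M_def by (rule AE_uniform_measureI) auto
    then show "AE x in PiM I M. x i \<in> ball (c i) \<epsilon>"
      by (rule AE_PiM_component[OF prob \<open>i \<in> I\<close>])
  qed
  ultimately have ae: "AE x in PiM I M. alg_indep I x \<and> (\<forall>i\<in>I. x i \<in> ball (c i) \<epsilon>)"
    by eventually_elim simp
  interpret prob_space "PiM I M"
    by (rule prob_space_PiM) (rule prob)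
  have "\<exists>x. alg_indep I x \<and> (\<forall>i\<in>I. x i \<in> ball (c i) \<epsilon>)"
  proof (rule ccontr)
    assume "\<nexists>x. alg_indep I x \<and> (\<forall>i\<in>I. x i \<in> ball (c i) \<epsilon>)"
    then have "AE x in PiM I M. False"
      using ae by (elim eventually_mono) blast
    then show False by simp
  qed
  then show thesis using that by auto
qed

section \<open>Extending partial field isomorphisms\<close>

(* The graph of an isomorphism between two countable subfields of the complex numbers. *)
locale partial_field_iso =
  fixes G :: "(complex \<times> complex) set"
  assumes countable_graph: "countable G"
    and one: "(1, 1) \<in> G"
    and add: "(a, a') \<in> G \<Longrightarrow> (b, b') \<in> G \<Longrightarrow> (a + b, a' + b') \<in> G"
    and mult: "(a, a') \<in> G \<Longrightarrow> (b, b') \<in> G \<Longrightarrow> (a * b, a' * b') \<in> G"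
    and uminus: "(a, a') \<in> G \<Longrightarrow> (- a, - a') \<in> G"
    and inverse: "(a, a') \<in> G \<Longrightarrow> (inverse a, inverse a') \<in> G"
    and zero_iff: "(a, a') \<in> G \<Longrightarrow> a = 0 \<longleftrightarrow> a' = 0"
begin

lemma zero: "(0, 0) \<in> G"
  using add[OF one uminus[OF one]] by simp

lemma diff: "(a, a') \<in> G \<Longrightarrow> (b, b') \<in> G \<Longrightarrow> (a - b, a' - b') \<in> G"
  using add[OF _ uminus] by force

lemma divide: "(a, a') \<in> G \<Longrightarrow> (b, b') \<in> G \<Longrightarrow> (a / b, a' / b') \<in> G"
  using mult[OF _ inverse] by (simp add: divide_inverse)

lemma sum: "(\<And>i. i \<in> A \<Longrightarrow> (f i, f' i) \<in> G) \<Longrightarrow> (sum f A, sum f' A) \<in> G"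
  by (induction A rule: infinite_finite_induct) (auto intro: zero add)

lemma prod: "(\<And>i. i \<in> A \<Longrightarrow> (f i, f' i) \<in> G) \<Longrightarrow> (prod f A, prod f' A) \<in> G"
  by (induction A rule: infinite_finite_induct) (auto intro: one mult)

section \<open>Polynomials over the two subfields with corresponding coefficients\<close>

definition poly_rel :: "complex poly \<Rightarrow> complex poly \<Rightarrow> bool" where
  "poly_rel p p' \<longleftrightarrow> (\<forall>i. (coeff p i, coeff p' i) \<in> G)"

lemma poly_rel_const: "(a, a') \<in> G \<Longrightarrow> poly_rel [:a:] [:a':]"
  by (auto simp: poly_rel_def coeff_pCons zero split: nat.splits)

lemma poly_rel_add: "poly_rel p p' \<Longrightarrow> poly_rel q q' \<Longrightarrow> poly_rel (p + q) (p' + q')"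
  by (simp add: poly_rel_def add)

lemma poly_rel_diff: "poly_rel p p' \<Longrightarrow> poly_rel q q' \<Longrightarrow> poly_rel (p - q) (p' - q')"
  by (simp add: poly_rel_def diff)

lemma poly_rel_mult: "poly_rel p p' \<Longrightarrow> poly_rel q q' \<Longrightarrow> poly_rel (p * q) (p' * q')"
  unfolding poly_rel_def coeff_mult by (auto intro!: sum mult)

lemma poly_rel_monom: "(a, a') \<in> G \<Longrightarrow> poly_rel (monom a n) (monom a' n)"
  by (simp add: poly_rel_def zero)

lemma poly_rel_zero_iff: "poly_rel p p' \<Longrightarrow> p = 0 \<longleftrightarrow> p' = 0"
  unfolding poly_rel_def poly_eq_iff using zero_iff by auto

lemma poly_rel_degree: "poly_rel p p' \<Longrightarrow> degree p = degree p'"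
  unfolding poly_rel_def degree_def using zero_iff by metis

text \<open>Cancelling leading terms uses only field operations, under which \<open>G\<close> is
  closed. Euclidean division can therefore run on both sides at once, with corresponding quotients
  and remainders.\<close>

lemma poly_rel_division:
  assumes "poly_rel p p'" "poly_rel m m'" "m \<noteq> 0"
  obtains q q' r r' where "poly_rel q q'" "poly_rel r r'" "p = q * m + r" "p' = q' * m' + r'"
    "r = 0 \<or> degree r < degree m"
  using assms(1)
\<comment> \<open>The zero polynomial shares degree 0 with the nonzero constants; the shift by one
  makes the step from a constant to 0 a decrease.\<close>
proof (induction "if p = 0 then 0 else Suc (degree p)" arbitrary: p p' thesis rule: less_induct)
  case less
  show ?case
  proof (cases "p = 0 \<or> degree p < degree m")
    case True
    then show ?thesis
      using less.prems(1)[of "[:0:]" "[:0:]" p p'] less.prems(2) poly_rel_const[OF zero] by auto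
  next
    case False
    define n where "n = degree p - degree m"
    define c where "c = lead_coeff p / lead_coeff m"
    define c' where "c' = lead_coeff p' / lead_coeff m'"
    note deg = poly_rel_degree[OF less.prems(2)] poly_rel_degree[OF assms(2)]
    have c: "(c, c') \<in> G"
      unfolding c_def c'_def using less.prems(2) assms(2) deg
      by (intro divide) (simp_all add: poly_rel_def)
    have "c \<noteq> 0" using False assms(3) by (simp add: c_def)
    define s where "s = p - monom c n * m"
    define s' where "s' = p' - monom c' n * m'"
    have s: "poly_rel s s'"
      unfolding s_def s'_def
      by (intro poly_rel_diff poly_rel_mult poly_rel_monom c less.prems assms)
    have dm: "degree (monom c n * m) = degree p"
      using \<open>c \<noteq> 0\<close> assms(3) False by (simp add: degree_mult_eq degree_monom_eq n_def)
    have "coeff (monom c n * m) (degree p) = lead_coeff p"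
      using lead_coeff_mult[of "monom c n" m] dm \<open>c \<noteq> 0\<close> assms(3)
      by (simp add: degree_monom_eq c_def)
    then have "coeff s (degree p) = 0"
      by (simp add: s_def)
    moreover have "degree s \<le> degree p"
      unfolding s_def by (rule degree_diff_le) (simp_all add: dm)
    ultimately have "s = 0 \<or> degree s < degree p"
      by (metis leading_coeff_0_iff le_neq_implies_less)
    then have lt: "(if s = 0 then 0 else Suc (degree s)) < (if p = 0 then 0 else Suc (degree p))"
      using False by auto
    obtain q q' r r' where
      "poly_rel q q'" "poly_rel r r'" "s = q * m + r" "s' = q' * m' + r'"
      "r = 0 \<or> degree r < degree m"
      by (rule less.hyps[OF lt _ s]) blast
    moreover have "poly_rel (monom c n + q) (monom c' n + q')"
      using poly_rel_add poly_rel_monom c \<open>poly_rel q q'\<close> by blast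
    ultimately show ?thesis
      using less.prems(1)[of "monom c n + q" "monom c' n + q'" r r']
      by (simp add: s_def s'_def algebra_simps)
  qed
qed

text \<open>Polynomials are finite coefficient lists over a countable set. This leaves room for a
  transcendental \<open>y\<close> and keeps extended graphs countable.\<close>

lemma countable_poly_rel: "countable {(p, p'). poly_rel p p'}"
proof -
  have *: "p \<in> Poly ` lists A" if "range (coeff p) \<subseteq> A" for p :: "complex poly" and A
  proof -
    have "set (coeffs p) \<subseteq> A"
      using that by (auto simp: coeffs_def)
    then have "coeffs p \<in> lists A" by auto
    then show ?thesis by (metis Poly_coeffs imageI)
  qed
  have "{(p, p'). poly_rel p p'} \<subseteq> (Poly ` lists (fst ` G)) \<times> (Poly ` lists (snd ` G))"
    by (auto intro!: *) (auto simp: poly_rel_def intro: rev_image_eqI)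
  moreover have "countable ((Poly ` lists (fst ` G)) \<times> (Poly ` lists (snd ` G)))"
    using countable_graph by (intro countable_SIGMA countable_image countable_lists) auto
  ultimately show ?thesis by (rule countable_subset)
qed

(* If x is transcendental over the domain, so is y over the range, by countability.  Otherwise y is
   a root of the image of the minimal polynomial m of x; that image is irreducible, because a proper
   factor s would pull back to a proper factor of m. *)
lemma exists_conjugate_root:
  fixes x :: complex
  obtains y where "\<And>p p'. poly_rel p p' \<Longrightarrow> poly p x = 0 \<longleftrightarrow> poly p' y = 0"
proof (cases "\<exists>m m'. poly_rel m m' \<and> m \<noteq> 0 \<and> poly m x = 0")
  case False
  define Z where "Z = (\<Union>(p, p')\<in>{(p, p'). poly_rel p p'}. if p' = 0 then {} else {y. poly p' y = 0})"
  have "countable Z"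
    unfolding Z_def
    by (rule countable_UN[OF countable_poly_rel]) (auto intro!: countable_finite poly_roots_finite split: if_splits)
  then obtain y where y: "y \<notin> Z"
    using uncountable_UNIV_complex by (metis UNIV_eq_I)
  have "poly p x = 0 \<longleftrightarrow> poly p' y = 0" if "poly_rel p p'" for p p'
  proof -
    have "poly p' y = 0 \<Longrightarrow> p' = 0"
      using y that by (auto simp: Z_def split: if_splits)
    then show ?thesis
      using False that poly_rel_zero_iff[OF that] by auto
  qed
  then show thesis by (rule that)
next
  case True
  let ?P = "\<lambda>n. \<exists>m m'. poly_rel m m' \<and> m \<noteq> 0 \<and> poly m x = 0 \<and> degree m = n"
  have "\<exists>n. ?P n" using True by blast
  then have "?P (LEAST n. ?P n)" by (rule LeastI_ex)
  then obtain m m' where m: "poly_rel m m'" "m \<noteq> 0" "poly m x = 0"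
    and "degree m = (LEAST n. ?P n)" by blast
  then have min: "degree m \<le> degree s" if "poly_rel s s'" "s \<noteq> 0" "poly s x = 0" for s s'
    using that by (metis (mono_tags, lifting) Least_le)
  have "degree m \<noteq> 0"
    using m(2,3) by (auto elim!: degree_eq_zeroE)
  then have "degree m' \<noteq> 0" using poly_rel_degree m(1) by simp
  then obtain y where y: "poly m' y = 0"
    by (metis constant_degree fundamental_theorem_of_algebra)
  \<comment> \<open>The \<open>s\<close> of least degree is, up to a scalar, the pullback of the
    minimal polynomial of \<open>y\<close>. It divides every \<open>t\<close> whose image vanishes
    at \<open>y\<close>, so it remains to see that \<open>s\<close> vanishes at
    \<open>x\<close>.\<close>
  let ?Q = "\<lambda>n. \<exists>s s'. poly_rel s s' \<and> s \<noteq> 0 \<and> poly s' y = 0 \<and> degree s = n"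
  have "\<exists>n. ?Q n" using m y by blast
  then have "?Q (LEAST n. ?Q n)" by (rule LeastI_ex)
  then obtain s s' where s: "poly_rel s s'" "s \<noteq> 0" "poly s' y = 0"
    and "degree s = (LEAST n. ?Q n)" by blast
  then have mins: "degree s \<le> degree t" if "poly_rel t t'" "t \<noteq> 0" "poly t' y = 0" for t t'
    using that by (metis (mono_tags, lifting) Least_le)
  have s_dvd: "s dvd t" if t: "poly_rel t t'" "poly t' y = 0" for t t'
  proof -
    obtain q q' r r' where *: "poly_rel q q'" "poly_rel r r'" "t = q * s + r" "t' = q' * s' + r'"
      "r = 0 \<or> degree r < degree s"
      using poly_rel_division[OF t(1) s(1,2)] by metis
    have "poly r' y = 0" using *(4) t(2) s(3) by simp
    then have "r = 0" using mins[OF *(2)] *(5) by (meson not_le)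
    then show ?thesis using *(3) by simp
  qed
  \<comment> \<open>Otherwise \<open>m = q * s\<close> forces \<open>q\<close> to vanish at
    \<open>x\<close>. Minimality of \<open>m\<close> then makes \<open>s\<close> constant, but its
    image is nonzero and has the root \<open>y\<close>.\<close>
  have "poly s x = 0"
  proof (rule ccontr)
    assume sx: "poly s x \<noteq> 0"
    obtain q q' r r' where *: "poly_rel q q'" "poly_rel r r'" "m = q * s + r" "m' = q' * s' + r'"
      "r = 0 \<or> degree r < degree s"
      using poly_rel_division[OF m(1) s(1,2)] by metis
    have "poly r' y = 0" using *(4) y s(3) by simp
    then have "r = 0" using mins[OF *(2)] *(5) by (meson not_le)
    then have "m = q * s" using * by simp
    then have q: "q \<noteq> 0" "poly q x = 0" using m sx by auto
    then have "degree s = 0"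
      using min[OF *(1)] \<open>m = q * s\<close> s(2) by (simp add: degree_mult_eq)
    then have "degree s' = 0" using poly_rel_degree[OF s(1)] by simp
    then obtain c where "s' = [:c:]" by (rule degree_eq_zeroE)
    then show False using s poly_rel_zero_iff[OF s(1)] by simp
  qed
  have "poly p x = 0 \<longleftrightarrow> poly p' y = 0" if p: "poly_rel p p'" for p p'
  proof
    assume "poly p' y = 0"
    then show "poly p x = 0" using s_dvd[OF p] \<open>poly s x = 0\<close> by auto
  next
    assume px: "poly p x = 0"
    obtain q q' r r' where *: "poly_rel q q'" "poly_rel r r'" "p = q * m + r" "p' = q' * m' + r'"
      "r = 0 \<or> degree r < degree m"
      using poly_rel_division[OF p m(1,2)] by metis
    have "poly r x = 0" using *(3) px m(3) by simp
    then have "r = 0" using min[OF *(2)] *(5) by (meson not_le)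
    then have "r' = 0" using poly_rel_zero_iff[OF *(2)] by simp
    then show "poly p' y = 0" using *(4) y by simp
  qed
  then show thesis by (rule that)
qed

text \<open>The simple extension by \<open>x\<close> consists of quotients of polynomial values at
  \<open>x\<close>, and these are mapped to the corresponding quotients at \<open>y\<close>. By the
  choice of \<open>y\<close> a denominator vanishes at \<open>x\<close> exactly when its image
  vanishes at \<open>y\<close>.\<close>

lemma extend:
  obtains G' y where "partial_field_iso G'" "G \<subseteq> G'" "(x, y) \<in> G'"
proof -
  obtain y where y: "\<And>p p'. poly_rel p p' \<Longrightarrow> poly p x = 0 \<longleftrightarrow> poly p' y = 0"
    using exists_conjugate_root[of x] by metis
  define G' where "G' = {(poly p x / poly q x, poly p' y / poly q' y) | p p' q q'.
    poly_rel p p' \<and> poly_rel q q' \<and> poly q x \<noteq> 0}"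
  have intro: "(a, b) \<in> G'" if "poly_rel p p'" "poly_rel q q'" "poly q x \<noteq> 0"
    "a = poly p x / poly q x" "b = poly p' y / poly q' y" for a b p p' q q'
    using that by (auto simp: G'_def)
  have elim: "\<exists>p p' q q'. poly_rel p p' \<and> poly_rel q q' \<and> poly q x \<noteq> 0 \<and> poly q' y \<noteq> 0 \<and>
    a = poly p x / poly q x \<and> b = poly p' y / poly q' y" if "(a, b) \<in> G'" for a b
    using that y unfolding G'_def by blast
  note one' = poly_rel_const[OF one]
  have "partial_field_iso G'"
  proof
    have "G' \<subseteq> (\<lambda>((p, p'), (q, q')). (poly p x / poly q x, poly p' y / poly q' y)) `
      ({(p, p'). poly_rel p p'} \<times> {(q, q'). poly_rel q q'})"
      unfolding G'_def by force
    then show "countable G'"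
      using countable_poly_rel by (meson countable_SIGMA countable_image countable_subset)
    show "(1, 1) \<in> G'"
      by (rule intro[OF one' one']) auto
  next
    fix a a' assume "(a, a') \<in> G'"
    then obtain p p' q q' where
      *: "poly_rel p p'" "poly_rel q q'" "poly q x \<noteq> 0" "poly q' y \<noteq> 0"
      "a = poly p x / poly q x" "a' = poly p' y / poly q' y"
      using elim by blast
    show "a = 0 \<longleftrightarrow> a' = 0" using * y by simp
    show "(- a, - a') \<in> G'"
      using * poly_rel_diff[OF poly_rel_const[OF zero] *(1)]
      by (intro intro[of "[:0:] - p" "[:0:] - p'" q q']) auto
    show "(inverse a, inverse a') \<in> G'"
    \<comment> \<open>For zero the convention \<open>inverse 0 = 0\<close> applies on both sides, so
      the pair of zeros is what has to be in the graph.\<close>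
    proof (cases "poly p x = 0")
      case True
      then have "poly p' y = 0" using y[OF *(1)] by simp
      then show ?thesis
        using * True intro[OF poly_rel_const[OF zero] one'] by simp
    next
      case False
      then show ?thesis using * by (intro intro[of q q' p p']) auto
    qed
    fix b b' assume "(b, b') \<in> G'"
    then obtain r r' s s' where
      **: "poly_rel r r'" "poly_rel s s'" "poly s x \<noteq> 0" "poly s' y \<noteq> 0"
      "b = poly r x / poly s x" "b' = poly r' y / poly s' y"
      using elim by blast
    show "(a + b, a' + b') \<in> G'"
      by (rule intro[of "p * s + r * q" "p' * s' + r' * q'" "q * s" "q' * s'"])
        (use * ** in \<open>auto intro!: poly_rel_add poly_rel_mult simp: add_frac_eq\<close>)
    show "(a * b, a' * b') \<in> G'"
      by (rule intro[of "p * r" "p' * r'" "q * s" "q' * s'"])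
        (use * ** in \<open>auto intro!: poly_rel_mult\<close>)
  qed
  moreover have "G \<subseteq> G'"
  proof
    fix g assume "g \<in> G"
    then show "g \<in> G'"
      by (cases g) (auto intro: intro[OF poly_rel_const[of "fst g" "snd g"] one'])
  qed
  moreover have "(x, y) \<in> G'"
    by (rule intro[OF poly_rel_monom[OF one, of 1] one']) (auto simp: poly_monom)
  ultimately show thesis by (rule that)
qed

lemma extend_finite:
  assumes "finite E"
  obtains G' where "partial_field_iso G'" "G \<subseteq> G'" "\<And>e. e \<in> E \<Longrightarrow> \<exists>y. (e, y) \<in> G'"
  using assms
proof (induction E arbitrary: thesis rule: finite_induct)
  case empty
  show ?case by (rule empty[OF partial_field_iso_axioms]) auto
next
  case (insert e E)
  obtain G1 where G1: "partial_field_iso G1" "G \<subseteq> G1" "\<And>e. e \<in> E \<Longrightarrow> \<exists>y. (e, y) \<in> G1"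
    using insert.IH by metis
  obtain G2 y where "partial_field_iso G2" "G1 \<subseteq> G2" "(e, y) \<in> G2"
    using partial_field_iso.extend[OF G1(1)] by metis
  then show ?case using G1 by (intro insert.prems[of G2]) blast+
qed

section \<open>Matrices with corresponding entries\<close>

definition mat_rel :: "complex mat \<Rightarrow> complex mat \<Rightarrow> bool" where
  "mat_rel A A' \<longleftrightarrow> dim_row A = dim_row A' \<and> dim_col A = dim_col A' \<and>
    (\<forall>i<dim_row A. \<forall>j<dim_col A. (A $$ (i, j), A' $$ (i, j)) \<in> G)"

lemma mat_rel_mult:
  assumes "mat_rel A A'" "mat_rel B B'" "dim_col A = dim_row B"
  shows "mat_rel (A * B) (A' * B')"
  using assms by (auto simp: mat_rel_def scalar_prod_def intro!: sum mult)

lemma mat_rel_zero_mat: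
  assumes "mat_rel A A'" "A = 0\<^sub>m n m"
  shows "A' = 0\<^sub>m n m"
  using assms zero_iff by (intro eq_matI) (auto simp: mat_rel_def)

text \<open>By the Leibniz formula the two determinants correspond under \<open>G\<close>; if the
  matrices are not square, both are 0 by convention.\<close>

lemma mat_rel_det:
  assumes "mat_rel A A'"
  shows "det A = 0 \<longleftrightarrow> det A' = 0"
proof (rule zero_iff)
  have "(signof p * (\<Prod>i = 0..<dim_row A. A $$ (i, p i)),
      signof p * (\<Prod>i = 0..<dim_row A. A' $$ (i, p i))) \<in> G"
    if "p permutes {0..<dim_row A}" "dim_row A = dim_col A" for p
  proof (intro mult prod)
    show "(signof p, signof p) \<in> G"
      using one uminus[OF one] by (auto simp: sign_def)
  next
    fix i assume "i \<in> {0..<dim_row A}"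
    then show "(A $$ (i, p i), A' $$ (i, p i)) \<in> G"
      using assms that permutes_in_image[OF that(1), of i] by (auto simp: mat_rel_def)
  qed
  then show "(det A, det A') \<in> G"
    using assms by (auto simp: det_def mat_rel_def intro!: sum zero)
qed

lemma mat_rel_exists:
  assumes "\<And>i j. i < dim_row A \<Longrightarrow> j < dim_col A \<Longrightarrow> \<exists>y. (A $$ (i, j), y) \<in> G"
  obtains A' where "mat_rel A A'"
proof
  show "mat_rel A (mat (dim_row A) (dim_col A) (\<lambda>ij. SOME y. (A $$ ij, y) \<in> G))"
    using assms by (auto simp: mat_rel_def intro: someI_ex)
qed

end

text \<open>The same expressions vanish at both tuples, namely those that vanish identically. Hence
  mapping a quotient of values at one tuple to the same quotient at the other is well defined and
  injective on the generated subfield.\<close>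

lemma partial_field_iso_alg_indep:
  fixes h :: "'v::countable \<Rightarrow> complex"
  assumes "alg_indep I h" "alg_indep I h'"
  obtains G where "partial_field_iso G" "\<And>i. i \<in> I \<Longrightarrow> (h i, h' i) \<in> G"
proof -
  define x where "x = override_on (\<lambda>_. 0) h I"
  define x' where "x' = override_on (\<lambda>_. 0) h' I"
  have iff: "peval e x = 0 \<longleftrightarrow> peval e x' = 0" for e
    using assms unfolding alg_indep_def x_def x'_def by blast
  define G where "G = {(peval e x / peval f x, peval e x' / peval f x') | e f. peval f x \<noteq> 0}"
  have intro: "(a, b) \<in> G" if "peval f x \<noteq> 0"
    "a = peval e x / peval f x" "b = peval e x' / peval f x'" for a b e f
    using that by (auto simp: G_def)
  have elim: "\<exists>e f. peval f x \<noteq> 0 \<and> peval f x' \<noteq> 0 \<and>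
    a = peval e x / peval f x \<and> b = peval e x' / peval f x'" if "(a, b) \<in> G" for a b
    using that iff unfolding G_def by blast
  have "partial_field_iso G"
  proof
    have "G \<subseteq> range (\<lambda>(e, f). (peval e x / peval f x, peval e x' / peval f x'))"
      unfolding G_def by auto
    then show "countable G"
      by (rule countable_subset) simp
    show "(1, 1) \<in> G"
      by (rule intro[of "Cst 1" _ "Cst 1"]) auto
  next
    fix a a' assume "(a, a') \<in> G"
    then obtain e f where *: "peval f x \<noteq> 0" "peval f x' \<noteq> 0"
      "a = peval e x / peval f x" "a' = peval e x' / peval f x'"
      using elim by blast
    show "a = 0 \<longleftrightarrow> a' = 0" using * iff by simp
    show "(- a, - a') \<in> G"
      using * by (intro intro[of f _ "Mul (Cst (-1)) e"]) auto
    show "(inverse a, inverse a') \<in> G"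
    proof (cases "peval e x = 0")
      case True
      then show ?thesis
        using * iff[of e] by (intro intro[of "Cst 1" _ "Cst 0"]) auto
    next
      case False
      then show ?thesis using * by (intro intro[of e _ f]) auto
    qed
    fix b b' assume "(b, b') \<in> G"
    then obtain g k where **: "peval k x \<noteq> 0" "peval k x' \<noteq> 0"
      "b = peval g x / peval k x" "b' = peval g x' / peval k x'"
      using elim by blast
    show "(a + b, a' + b') \<in> G"
      using * ** by (intro intro[of "Mul f k" _ "Add (Mul e k) (Mul g f)"]) (auto simp: add_frac_eq)
    show "(a * b, a' * b') \<in> G"
      using * ** by (intro intro[of "Mul f k" _ "Mul e g"]) auto
  qed
  moreover have "(h i, h' i) \<in> G" if "i \<in> I" for i
    using that by (intro intro[of "Cst 1" _ "Var i"]) (auto simp: x_def x'_def)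
  ultimately show thesis by (rule that)
qed

section \<open>Solutions near a decoupled channel\<close>

text \<open>Banach's fixed point theorem on the unit ball of the supremum norm, with the norm
  spelled out as a bound at every index. The iterates of 0 converge at each index at a geometric
  rate.\<close>

lemma contraction_fixed_point:
  fixes T :: "('i \<Rightarrow> complex) \<Rightarrow> 'i \<Rightarrow> complex"
  assumes bounded: "\<And>x e. (\<And>e. cmod (x e) \<le> 1) \<Longrightarrow> cmod (T x e) \<le> 1"
    and contract: "\<And>x y r e. (\<And>e. cmod (x e) \<le> 1) \<Longrightarrow> (\<And>e. cmod (y e) \<le> 1) \<Longrightarrow>
      (\<And>e. cmod (x e - y e) \<le> r) \<Longrightarrow> cmod (T x e - T y e) \<le> r / 2"
  obtains x where "\<And>e. cmod (x e) \<le> 1" "\<And>e. T x e = x e"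
proof -
  define X where "X n = (T ^^ n) (\<lambda>_. 0)" for n
  have X_Suc: "X (Suc n) = T (X n)" for n
    by (simp add: X_def)
  have X_le: "cmod (X n e) \<le> 1" for n e
    by (induction n arbitrary: e) (simp_all add: X_Suc bounded, simp add: X_def)
  have step: "cmod (X (Suc n) e - X n e) \<le> (1/2) ^ n" for n e
  proof (induction n arbitrary: e)
    case 0
    then show ?case using X_le[of "Suc 0" e] by (simp add: X_def)
  next
    case (Suc n)
    then show ?case
      using contract[of "X (Suc n)" "X n" "(1/2) ^ n" e, OF X_le X_le] by (simp add: X_Suc)
  qed
  have "summable (\<lambda>n. X (Suc n) e - X n e)" for e
    by (rule summable_norm_cancel, rule summable_comparison_test'[of "\<lambda>n. (1/2) ^ n" 0])
      (simp_all add: step summable_geometric)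
  then have "convergent (\<lambda>n. \<Sum>i<n. X (Suc i) e - X i e)" for e
    by (simp add: summable_iff_convergent)
  then have "convergent (\<lambda>n. X n e - X 0 e)" for e
    by (simp only: sum_lessThan_telescope[of "\<lambda>n. X n e" for e])
  then have "convergent (\<lambda>n. X n e - X 0 e + X 0 e)" for e
    by (intro convergent_add convergent_const)
  then have "\<exists>l. (\<lambda>n. X n e) \<longlonglongrightarrow> l" for e
    by (simp add: convergent_def)
  then obtain x where x: "\<And>e. (\<lambda>n. X n e) \<longlonglongrightarrow> x e"
    by metis
  have x_le: "cmod (x e) \<le> 1" for e
    by (rule LIMSEQ_le_const2[OF tendsto_norm[OF x]]) (auto simp: X_le)
  \<comment> \<open>The right-hand side is the exact value of the geometric sum from
    \<open>n\<close> to \<open>m + n - 1\<close>; the subtracted term makes the induction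
    close.\<close>
  have tail: "cmod (X (m + n) e - X n e) \<le> 2 * (1/2) ^ n - 2 * (1/2) ^ (m + n)" for m n e
  proof (induction m)
    case (Suc m)
    have "cmod (X (Suc m + n) e - X n e)
        \<le> cmod (X (Suc (m + n)) e - X (m + n) e) + cmod (X (m + n) e - X n e)"
      using norm_triangle_ineq[of "X (Suc (m + n)) e - X (m + n) e" "X (m + n) e - X n e"] by simp
    also have "\<dots> \<le> (1/2) ^ (m + n) + (2 * (1/2) ^ n - 2 * (1/2) ^ (m + n))"
      by (intro add_mono step Suc)
    finally show ?case by simp
  qed simp
  have dist: "cmod (X n e - x e) \<le> 2 * (1/2) ^ n" for n e
  proof (rule LIMSEQ_le_const2)
    have "(\<lambda>m. X (m + n) e) \<longlonglongrightarrow> x e"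
      by (rule LIMSEQ_ignore_initial_segment[OF x])
    then show "(\<lambda>m. cmod (X n e - X (m + n) e)) \<longlonglongrightarrow> cmod (X n e - x e)"
      by (intro tendsto_intros)
    have "cmod (X n e - X (m + n) e) \<le> 2 * (1/2) ^ n" for m
    proof -
      have "(0::real) \<le> 2 * (1/2) ^ (m + n)" by simp
      then show ?thesis using tail[of m n e] by (subst norm_minus_commute) linarith
    qed
    then show "\<exists>N. \<forall>m\<ge>N. cmod (X n e - X (m + n) e) \<le> 2 * (1/2) ^ n"
      by blast
  qed
  have "T x e = x e" for e
  proof -
    \<comment> \<open>Pointwise convergence alone would not let \<open>T\<close> pass to the limit;
      the bound \<open>dist\<close> is uniform in the index, as \<open>contract\<close>
      requires.\<close>
    have le: "cmod (X (Suc n) e - T x e) \<le> (1/2) ^ n" for n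
      using contract[of "X n" x "2 * (1/2) ^ n" e, OF X_le x_le dist] by (simp add: X_Suc)
    have "(\<lambda>n. (1/2 :: real) ^ n) \<longlonglongrightarrow> 0"
      by (rule LIMSEQ_power_zero) simp
    then have "(\<lambda>n. X (Suc n) e - T x e) \<longlonglongrightarrow> 0"
      by (rule Lim_null_comparison[OF always_eventually, rotated]) (simp add: le)
    then have "(\<lambda>n. X (Suc n) e) \<longlonglongrightarrow> T x e"
      by (rule LIM_zero_cancel)
    then show ?thesis
      using LIMSEQ_unique LIMSEQ_Suc[OF x] by blast
  qed
  then show thesis using that x_le by blast
qed

text \<open>A kernel vector \<open>v\<close> equals the image of \<open>v\<close> under the identity
  minus \<open>A\<close>. At an entry of \<open>v\<close> of largest modulus \<open>c\<close> this
  would give \<open>c < c\<close>.\<close>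

lemma det_nonzero_near_identity:
  fixes A :: "complex mat"
  assumes A: "A \<in> carrier_mat n n"
    and near: "\<And>i j. i < n \<Longrightarrow> j < n \<Longrightarrow> real n * cmod (A $$ (i, j) - (if i = j then 1 else 0)) < 1"
  shows "det A \<noteq> 0"
proof
  assume "det A = 0"
  then obtain v where v: "v \<in> carrier_vec n" "v \<noteq> 0\<^sub>v n" "A *\<^sub>v v = 0\<^sub>v n"
    using det_0_iff_vec_prod_zero[OF A] by blast
  then obtain i0 where i0: "i0 < n" "v $ i0 \<noteq> 0"
    by (metis carrier_vecD eq_vecI index_zero_vec)
  define c where "c = Max ((\<lambda>i. cmod (v $ i)) ` {..<n})"
  have "c \<in> (\<lambda>i. cmod (v $ i)) ` {..<n}"
    unfolding c_def using i0 by (intro Max_in) auto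
  then obtain i where i: "i < n" "c = cmod (v $ i)" by auto
  have le: "cmod (v $ j) \<le> c" if "j < n" for j
    unfolding c_def using that by (intro Max_ge) auto
  have "c > 0" using le[OF i0(1)] i0(2) by (metis less_le_trans zero_less_norm_iff)
  have "(\<Sum>j<n. A $$ (i, j) * v $ j) = (A *\<^sub>v v) $ i"
    using A v(1) i(1) by (auto simp: scalar_prod_def atLeast0LessThan)
  then have "(\<Sum>j<n. A $$ (i, j) * v $ j) = 0"
    using v(3) i(1) by simp
  moreover have "(\<Sum>j<n. (if i = j then 1 else 0) * v $ j) = v $ i"
    using i(1) by (simp add: if_distrib[of "\<lambda>x. x * _"] cong: if_cong)
  ultimately have "v $ i = - (\<Sum>j<n. (A $$ (i, j) - (if i = j then 1 else 0)) * v $ j)"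
    by (simp add: left_diff_distrib sum_subtractf)
  then have "c = cmod (\<Sum>j<n. (A $$ (i, j) - (if i = j then 1 else 0)) * v $ j)"
    using i(2) by simp
  also have "\<dots> \<le> (\<Sum>j<n. cmod (A $$ (i, j) - (if i = j then 1 else 0)) * c)"
    by (rule sum_norm_le) (simp add: norm_mult mult_left_mono le)
  also have "\<dots> < (\<Sum>j<n. 1 / real n * c)"
  proof (rule sum_strict_mono)
    fix j assume "j \<in> {..<n}"
    then show "cmod (A $$ (i, j) - (if i = j then 1 else 0)) * c < 1 / real n * c"
      using near[OF i(1), of j] \<open>c > 0\<close> i(1) by (intro mult_strict_right_mono) (auto simp: field_simps)
  qed (use i in auto)
  also have "\<dots> = c" using i(1) by simp
  finally show False by simp
qed

section \<open>Bilinear forms of small matrices and of 0-1 matrices\<close>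

definition bilin :: "nat \<Rightarrow> nat \<Rightarrow> (nat \<Rightarrow> nat \<Rightarrow> complex) \<Rightarrow> (nat \<Rightarrow> complex) \<Rightarrow> (nat \<Rightarrow> complex) \<Rightarrow> complex"
  where "bilin n m A f g = (\<Sum>i<n. \<Sum>j<m. f i * A i j * g j)"

lemma norm_bilin_le:
  assumes "\<And>i. i < n \<Longrightarrow> cmod (f i) \<le> r" "\<And>j. j < m \<Longrightarrow> cmod (g j) \<le> s"
    and "\<And>i j. i < n \<Longrightarrow> j < m \<Longrightarrow> cmod (A i j) \<le> \<epsilon>"
  shows "cmod (bilin n m A f g) \<le> real n * real m * \<epsilon> * r * s"
proof -
  have "cmod (bilin n m A f g) \<le> (\<Sum>i<n. \<Sum>j<m. r * \<epsilon> * s)"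
    unfolding bilin_def
  proof (intro sum_norm_le)
    fix i j assume "i \<in> {..<n}" "j \<in> {..<m}"
    then have le: "cmod (f i) \<le> r" "cmod (A i j) \<le> \<epsilon>" "cmod (g j) \<le> s"
      using assms by auto
    then have "0 \<le> r" "0 \<le> \<epsilon>"
      using norm_ge_zero order_trans by blast+
    then show "cmod (f i * A i j * g j) \<le> r * \<epsilon> * s"
      unfolding norm_mult using le by (intro mult_mono mult_nonneg_nonneg) auto
  qed
  then show ?thesis by (simp add: mult_ac)
qed

lemma bilin_diff: "bilin n m A f g - bilin n m A f' g' =
    bilin n m A (\<lambda>i. f i - f' i) g + bilin n m A f' (\<lambda>j. g j - g' j)"
  unfolding bilin_def
  by (simp add: left_diff_distrib right_diff_distrib sum_subtractf)

lemma bilin_add: "bilin n m (\<lambda>i j. A i j + B i j) f g = bilin n m A f g + bilin n m B f g"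
  unfolding bilin_def by (simp add: distrib_left distrib_right sum.distrib)

text \<open>This turns the matrix equations into scalar ones: an entry of the triple product is the
  form of a row of the left factor and a column of the right factor.\<close>

lemma index_mult_mult_mat:
  assumes "a < p" "b < q"
  shows "(mat p n (\<lambda>(a, i). f a i) * mat n m (\<lambda>(i, j). A i j) * mat m q (\<lambda>(j, b). g j b)) $$ (a, b) =
    bilin n m A (f a) (\<lambda>j. g j b)"
proof -
  have "(mat p n (\<lambda>(a, i). f a i) * mat n m (\<lambda>(i, j). A i j) * mat m q (\<lambda>(j, b). g j b)) $$ (a, b) =
    (\<Sum>j<m. (\<Sum>i<n. f a i * A i j) * g j b)"
    using assms by (simp add: scalar_prod_def atLeast0LessThan)
  also have "\<dots> = bilin n m A (f a) (\<lambda>j. g j b)"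
    unfolding bilin_def sum_distrib_right by (rule sum.swap)
  finally show ?thesis .
qed

text \<open>The matrix has a single 1 in each of its first \<open>m'\<close> columns, in row
  \<open>p j\<close>. Blocks of this shape and their transposes make up the decoupled
  channel.\<close>

lemma bilin_single_col:
  assumes "\<And>j. j < m' \<Longrightarrow> p j < n" "m' \<le> m"
  shows "bilin n m (\<lambda>i j. if j < m' \<and> i = p j then 1 else 0) f g = (\<Sum>j<m'. f (p j) * g j)"
proof -
  have "bilin n m (\<lambda>i j. if j < m' \<and> i = p j then 1 else 0) f g =
      (\<Sum>j<m. \<Sum>i<n. if j < m' \<and> i = p j then f i * g j else 0)"
    unfolding bilin_def by (subst sum.swap) (intro sum.cong refl, simp)
  also have "\<dots> = (\<Sum>j<m. if j < m' then f (p j) * g j else 0)"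
    using assms(1) by (intro sum.cong refl) auto
  also have "\<dots> = (\<Sum>j<m'. f (p j) * g j)"
    by (intro sum.mono_neutral_cong_right) (use assms(2) in auto)
  finally show ?thesis .
qed

lemma bilin_single_row:
  assumes "\<And>i. i < n' \<Longrightarrow> p i < m" "n' \<le> n"
  shows "bilin n m (\<lambda>i j. if i < n' \<and> j = p i then 1 else 0) f g = (\<Sum>i<n'. f i * g (p i))"
proof -
  have "bilin n m (\<lambda>i j. if i < n' \<and> j = p i then 1 else 0) f g =
      (\<Sum>i<n. \<Sum>j<m. if i < n' \<and> j = p i then f i * g j else 0)"
    unfolding bilin_def by (intro sum.cong refl, simp)
  also have "\<dots> = (\<Sum>i<n. if i < n' then f i * g (p i) else 0)"
    using assms(1) by (intro sum.cong refl) auto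
  also have "\<dots> = (\<Sum>i<n'. f i * g (p i))"
    by (intro sum.mono_neutral_cong_right) (use assms(2) in auto)
  finally show ?thesis .
qed

text \<open>\<open>W k\<close> stands for the Hermitian transpose of the receive filter, so no
  conjugation occurs and the conditions are polynomial. Full rank is encoded by nonzero determinants
  and by identity blocks in the first rows of \<open>V j\<close>; both survive a field
  isomorphism.\<close>

definition solves_alignment ::
  "nat set \<Rightarrow> nat set \<Rightarrow> (nat \<times> nat) set \<Rightarrow> (nat \<Rightarrow> nat) \<Rightarrow> (nat \<Rightarrow> nat) \<Rightarrow> (nat \<Rightarrow> nat) \<Rightarrow>
    (nat \<times> nat \<times> nat \<times> nat \<Rightarrow> complex) \<Rightarrow> (nat \<Rightarrow> complex mat) \<Rightarrow> (nat \<Rightarrow> complex mat) \<Rightarrow> bool"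
where
  "solves_alignment Rx Tx A M N d h W V \<longleftrightarrow>
    (\<forall>k\<in>Rx. W k \<in> carrier_mat (d k) (N k)) \<and>
    (\<forall>j\<in>Tx. V j \<in> carrier_mat (M j) (d j)) \<and>
    (\<forall>k\<in>Rx. det (W k * mat (N k) (M k) (\<lambda>(n, m). h (k, k, n, m)) * V k) \<noteq> 0) \<and>
    (\<forall>j\<in>Tx. \<forall>m<d j. \<forall>b<d j. V j $$ (m, b) = (if m = b then 1 else 0)) \<and>
    (\<forall>(k, j)\<in>A. W k * mat (N k) (M j) (\<lambda>(n, m). h (k, j, n, m)) * V j = 0\<^sub>m (d k) (d j))"

text \<open>Receivers take care of the pairs in \<open>R\<close>, transmitters of those in
  \<open>S\<close>. For \<open>H = H0 + D\<close> each equation expresses its own unknown as minus a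
  form in \<open>D\<close>, which for small \<open>D\<close> is a contraction of the unit
  ball.\<close>

lemma solvable_near_decoupled_channel:
  fixes Rx Tx :: "nat set" and R S :: "(nat \<times> nat) set" and M N d :: "nat \<Rightarrow> nat"
  assumes fin: "finite Rx" "finite Tx"
    and sub: "Rx \<subseteq> Tx" "R \<subseteq> Rx \<times> Tx" "S \<subseteq> Rx \<times> Tx" "R \<inter> S = {}"
    and off_diag: "\<And>k j. (k, j) \<in> R \<union> S \<Longrightarrow> k \<noteq> j"
    and budget_N: "\<And>k. k \<in> Rx \<Longrightarrow> (\<Sum>j | (k, j) \<in> R. d j) + d k \<le> N k"
    and budget_M: "\<And>j. j \<in> Tx \<Longrightarrow> (\<Sum>k | (k, j) \<in> S. d k) + d j \<le> M j"
  obtains H0 :: "nat \<Rightarrow> nat \<Rightarrow> nat \<Rightarrow> nat \<Rightarrow> complex" and \<epsilon> :: real where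
    "\<epsilon> > 0"
    "\<And>H. (\<And>k j n m. k \<in> Rx \<Longrightarrow> j \<in> Tx \<Longrightarrow> n < N k \<Longrightarrow> m < M j \<Longrightarrow>
        cmod (H k j n m - H0 k j n m) \<le> \<epsilon>) \<Longrightarrow>
      \<exists>W V. solves_alignment Rx Tx (R \<union> S) M N d (\<lambda>(k, j, n, m). H k j n m) W V"
proof -
  \<comment> \<open>\<open>SR k\<close> lists the streams that receiver \<open>k\<close> has to
    suppress. The budget says that they fit into the \<open>N k - d k\<close> columns of
    \<open>W k\<close> beyond the identity block, one column for each stream; \<open>SS j\<close>
    plays the same role for the rows of \<open>V j\<close>.\<close>
  define SR where "SR k = (SIGMA j : {j. (k, j) \<in> R}. {..<d j})" for k
  define SS where "SS j = (SIGMA k : {k. (k, j) \<in> S}. {..<d k})" for j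
  have finR: "finite {j. (k, j) \<in> R}" for k
    by (rule finite_subset[OF _ fin(2)]) (use sub in auto)
  have finS: "finite {k. (k, j) \<in> S}" for j
    by (rule finite_subset[OF _ fin(1)]) (use sub in auto)
  have "\<exists>f. f ` SR k \<subseteq> {d k..<N k} \<and> inj_on f (SR k)" if "k \<in> Rx" for k
    using budget_N[OF that] finR by (intro card_le_inj) (auto simp: SR_def)
  then obtain p where p: "\<And>k. k \<in> Rx \<Longrightarrow> p k ` SR k \<subseteq> {d k..<N k} \<and> inj_on (p k) (SR k)"
    by metis
  have "\<exists>f. f ` SS j \<subseteq> {d j..<M j} \<and> inj_on f (SS j)" if "j \<in> Tx" for j
    using budget_M[OF that] finS by (intro card_le_inj) (auto simp: SS_def)
  then obtain q where q: "\<And>j. j \<in> Tx \<Longrightarrow> q j ` SS j \<subseteq> {d j..<M j} \<and> inj_on (q j) (SS j)"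
    by metis
  have p_range: "d k \<le> p k (j, b) \<and> p k (j, b) < N k" if "(k, j) \<in> R" "b < d j" for k j b
    using p[of k] sub(2) that by (fastforce simp: SR_def)
  have q_range: "d j \<le> q j (k, a) \<and> q j (k, a) < M j" if "(k, j) \<in> S" "a < d k" for k j a
    using q[of j] sub(3) that by (fastforce simp: SS_def)
  have dN: "d k \<le> N k" if "k \<in> Rx" for k using budget_N[OF that] by simp
  have dM: "d j \<le> M j" if "j \<in> Tx" for j using budget_M[OF that] by simp

  \<comment> \<open>The unknown \<open>x (k, j, a, b)\<close> of the equation for streams \<open>a\<close>, \<open>b\<close> is placed in \<open>W k\<close> if
    \<open>(k, j) \<in> R\<close> and in \<open>V j\<close> if \<open>(k, j) \<in> S\<close>.\<close>
  define w where "w x k a n =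
    (if n < d k then (if n = a then 1 else 0)
     else if n \<in> p k ` SR k then (case inv_into (SR k) (p k) n of (j, b) \<Rightarrow> x (k, j, a, b))
     else (0::complex))" for x :: "nat \<times> nat \<times> nat \<times> nat \<Rightarrow> complex" and k a n
  define v where "v x j b m =
    (if m < d j then (if m = b then 1 else 0)
     else if m \<in> q j ` SS j then (case inv_into (SS j) (q j) m of (k, a) \<Rightarrow> x (k, j, a, b))
     else (0::complex))" for x :: "nat \<times> nat \<times> nat \<times> nat \<Rightarrow> complex" and j b m
  have w_le: "cmod (w x k a n) \<le> 1" if "\<And>e. cmod (x e) \<le> 1" for x k a n
    using that by (auto simp: w_def split: prod.splits)
  have v_le: "cmod (v x j b m) \<le> 1" if "\<And>e. cmod (x e) \<le> 1" for x j b m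
    using that by (auto simp: v_def split: prod.splits)
  have w_diff: "cmod (w x k a n - w y k a n) \<le> r" if "\<And>e. cmod (x e - y e) \<le> r" for x y k a n r
    using that order_trans[OF norm_ge_zero that] by (auto simp: w_def split: prod.splits)
  have v_diff: "cmod (v x j b m - v y j b m) \<le> r" if "\<And>e. cmod (x e - y e) \<le> r" for x y j b m r
    using that order_trans[OF norm_ge_zero that] by (auto simp: v_def split: prod.splits)
  have w_p: "w x k a (p k (j, b)) = x (k, j, a, b)" if "(k, j) \<in> R" "b < d j" for x k j a b
  proof -
    have "(j, b) \<in> SR k" using that by (simp add: SR_def)
    moreover have "inj_on (p k) (SR k)" using p[of k] sub(2) that by auto
    ultimately show ?thesis using p_range[OF that] by (auto simp: w_def inv_into_f_f)
  qed
  have v_q: "v x j b (q j (k, a)) = x (k, j, a, b)" if "(k, j) \<in> S" "a < d k" for x k j a b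
  proof -
    have "(k, a) \<in> SS j" using that by (simp add: SS_def)
    moreover have "inj_on (q j) (SS j)" using q[of j] sub(3) that by auto
    ultimately show ?thesis using q_range[OF that] by (auto simp: v_def inv_into_f_f)
  qed

  \<comment> \<open>For \<open>R\<close>, transmit antenna \<open>m < d j\<close> reaches only
    receive antenna \<open>p k (j, m)\<close>, so the identity block of \<open>V j\<close> isolates
    one entry of \<open>W k\<close>. \<open>S\<close> is the mirror image, and the diagonal channel
    joins the two identity blocks.\<close>
  define H0 where "H0 k j n m =
    (if (k, j) \<in> R then (if m < d j \<and> n = p k (j, m) then 1 else 0)
     else if (k, j) \<in> S then (if n < d k \<and> m = q j (k, n) then 1 else 0)
     else if k = j then (if n < d k \<and> m = n then 1 else 0) else (0::complex))" for k j n m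
  have H0_R: "H0 k j = (\<lambda>n m. if m < d j \<and> n = p k (j, m) then 1 else 0)" if "(k, j) \<in> R" for k j
    using that by (simp add: H0_def fun_eq_iff)
  have H0_S: "H0 k j = (\<lambda>n m. if n < d k \<and> m = q j (k, n) then 1 else 0)"
    if "(k, j) \<in> S" for k j
    using that sub(4) by (auto simp: H0_def fun_eq_iff)
  have H0_diag: "H0 k k = (\<lambda>n m. if n < d k \<and> m = n then 1 else 0)" for k
    using off_diag[of k k] by (auto simp: H0_def fun_eq_iff)
  have pick: "(\<Sum>i<l. f i * (if i = c then 1 else 0)) = f c" if "c < l"
    for f :: "nat \<Rightarrow> complex" and l c
  proof -
    have "(\<Sum>i<l. f i * (if i = c then 1 else 0)) = (\<Sum>i<l. if i = c then f i else 0)"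
      by (rule sum.cong) auto
    then show ?thesis using that by simp
  qed
  \<comment> \<open>For the channel \<open>H0\<close> the equation with index \<open>(k, j, a, b)\<close> reads \<open>x (k, j, a, b) = 0\<close>.\<close>
  have bilin_H0: "bilin (N k) (M j) (H0 k j) (w x k a) (v x j b) = x (k, j, a, b)"
    if kj: "(k, j) \<in> R \<union> S" and a: "a < d k" and b: "b < d j" for x k j a b
  proof (cases "(k, j) \<in> R")
    case True
    have "bilin (N k) (M j) (H0 k j) (w x k a) (v x j b) = (\<Sum>m<d j. w x k a (p k (j, m)) * v x j b m)"
      unfolding H0_R[OF True]
      by (rule bilin_single_col) (use True p_range dM sub(2) in auto)
    also have "\<dots> = (\<Sum>m<d j. x (k, j, a, m) * (if m = b then 1 else 0))"
      by (rule sum.cong) (use True in \<open>auto simp: w_p v_def\<close>)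
    finally show ?thesis using pick[OF b] by simp
  next
    case False
    then have S: "(k, j) \<in> S" using kj by simp
    have "bilin (N k) (M j) (H0 k j) (w x k a) (v x j b) = (\<Sum>n<d k. w x k a n * v x j b (q j (k, n)))"
      unfolding H0_S[OF S]
      by (rule bilin_single_row) (use S q_range dN sub(3) in auto)
    also have "\<dots> = (\<Sum>n<d k. x (k, j, n, b) * (if n = a then 1 else 0))"
      by (rule sum.cong) (use S in \<open>auto simp: v_q w_def\<close>)
    finally show ?thesis using pick[OF a, of "\<lambda>n. x (k, j, n, b)"] by simp
  qed
  have bilin_H0_diag: "bilin (N k) (M k) (H0 k k) (w x k a) (v x k b) = (if a = b then 1 else 0)"
    if k: "k \<in> Rx" and a: "a < d k" and b: "b < d k" for x k a b
  proof -
    have "d k \<le> N k" "d k \<le> M k"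
      using k dN dM sub(1) by auto
    then have "bilin (N k) (M k) (H0 k k) (w x k a) (v x k b) = (\<Sum>n<d k. w x k a n * v x k b n)"
      unfolding H0_diag by (intro bilin_single_row) auto
    also have "\<dots> = (\<Sum>n<d k. (if n = b then 1 else 0) * (if n = a then 1 else 0))"
      by (rule sum.cong) (auto simp: v_def w_def)
    finally show ?thesis using pick[OF a, of "\<lambda>n. if n = b then 1 else 0"] by simp
  qed

  \<comment> \<open>\<open>L\<close> dominates every product \<open>N k * M j * (d k + 1)\<close>,
    and the final 1 keeps it positive. The factor \<open>d k + 1\<close> serves the determinant
    criterion and is at least 1, so the plain bound follows as well. The 4 lets the two terms of the
    contraction estimate add up to one half.\<close>
  define L where "L = (\<Sum>k\<in>Rx. \<Sum>j\<in>Tx. N k * M j * (d k + 1)) + 1"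
  define \<epsilon> where "\<epsilon> = 1 / (4 * real L)"
  have "L > 0" by (simp add: L_def)
  then have "\<epsilon> > 0" by (simp add: \<epsilon>_def)
  have small: "real (N k) * real (M j) * real (d k + 1) * \<epsilon> \<le> 1 / 4" if "k \<in> Rx" "j \<in> Tx" for k j
  proof -
    have "N k * M j * (d k + 1) \<le> (\<Sum>j\<in>Tx. N k * M j * (d k + 1))"
      by (rule member_le_sum) (use that fin in auto)
    also have "\<dots> \<le> (\<Sum>k\<in>Rx. \<Sum>j\<in>Tx. N k * M j * (d k + 1))"
      by (rule member_le_sum[of k Rx "\<lambda>k. \<Sum>j\<in>Tx. N k * M j * (d k + 1)"]) (use that fin in auto)
    also have "\<dots> \<le> L" by (simp add: L_def)
    finally have "real (N k) * real (M j) * real (d k + 1) \<le> real L"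
      by (metis of_nat_le_iff of_nat_mult)
    then show ?thesis using \<open>L > 0\<close> by (simp add: \<epsilon>_def)
  qed
  show thesis
  proof (rule that[OF \<open>\<epsilon> > 0\<close>, of H0])
    fix H :: "nat \<Rightarrow> nat \<Rightarrow> nat \<Rightarrow> nat \<Rightarrow> complex"
    assume near: "\<And>k j n m. k \<in> Rx \<Longrightarrow> j \<in> Tx \<Longrightarrow> n < N k \<Longrightarrow> m < M j \<Longrightarrow>
        cmod (H k j n m - H0 k j n m) \<le> \<epsilon>"
    define D where "D k j n m = H k j n m - H0 k j n m" for k j n m
    have bilin_H: "bilin (N k) (M j) (H k j) f g = bilin (N k) (M j) (H0 k j) f g + bilin (N k) (M j) (D k j) f g"
      for k j f g
      using bilin_add[of "N k" "M j" "H0 k j" "D k j"] by (simp add: D_def)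
    have bilin_D: "cmod (bilin (N k) (M j) (D k j) f g) * real (d k + 1) \<le> r * s / 4"
      if "k \<in> Rx" "j \<in> Tx" "\<And>n. cmod (f n) \<le> r" "\<And>m. cmod (g m) \<le> s" for k j f g r s
    proof -
      have "0 \<le> r" "0 \<le> s"
        using that(3,4) norm_ge_zero order_trans by blast+
      have "cmod (bilin (N k) (M j) (D k j) f g) \<le> real (N k) * real (M j) * \<epsilon> * r * s"
        using that near by (intro norm_bilin_le) (auto simp: D_def)
      then have "cmod (bilin (N k) (M j) (D k j) f g) * real (d k + 1)
          \<le> real (N k) * real (M j) * \<epsilon> * r * s * real (d k + 1)"
        by (rule mult_right_mono) simp
      also have "\<dots> = (real (N k) * real (M j) * real (d k + 1) * \<epsilon>) * (r * s)"
        by (simp add: mult_ac)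
      also have "\<dots> \<le> 1 / 4 * (r * s)"
        by (rule mult_right_mono[OF small[OF that(1,2)]]) (use \<open>0 \<le> r\<close> \<open>0 \<le> s\<close> in simp)
      finally show ?thesis by simp
    qed
    have bilin_D': "cmod (bilin (N k) (M j) (D k j) f g) \<le> r * s / 4"
      if "k \<in> Rx" "j \<in> Tx" "\<And>n. cmod (f n) \<le> r" "\<And>m. cmod (g m) \<le> s" for k j f g r s
    proof -
      have "cmod (bilin (N k) (M j) (D k j) f g) * 1 \<le> cmod (bilin (N k) (M j) (D k j) f g) * real (d k + 1)"
        by (rule mult_left_mono) auto
      then show ?thesis using bilin_D[of k j f r g s, OF that] by simp
    qed
    \<comment> \<open>By \<open>bilin_H0\<close> the equation at \<open>(k, j, a, b)\<close> says
      that \<open>x\<close> there plus the form in \<open>D\<close> is 0, so fixed points of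
      \<open>T\<close> solve all equations. Pairs outside \<open>R\<close> and \<open>S\<close> get
      the value 0.\<close>
    define T where "T x = (\<lambda>(k, j, a, b). if (k, j) \<in> R \<union> S
      then - bilin (N k) (M j) (D k j) (w x k a) (v x j b) else 0)" for x
    have RS: "k \<in> Rx" "j \<in> Tx" if "(k, j) \<in> R \<union> S" for k j
      using that sub by auto
    obtain x where x: "\<And>e. cmod (x e) \<le> 1" and fix_x: "\<And>e. T x e = x e"
    proof (rule contraction_fixed_point[of T])
      fix x :: "nat \<times> nat \<times> nat \<times> nat \<Rightarrow> complex" and e :: "nat \<times> nat \<times> nat \<times> nat"
      assume x: "\<And>e. cmod (x e) \<le> 1"
      obtain k j a b where e: "e = (k, j, a, b)" by (metis prod_cases4)
      show "cmod (T x e) \<le> 1"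
        using bilin_D'[of k j "w x k a" 1 "v x j b" 1] w_le[OF x] v_le[OF x] RS[of k j]
        by (auto simp: T_def e)
    next
      fix x y :: "nat \<times> nat \<times> nat \<times> nat \<Rightarrow> complex" and r
        and e :: "nat \<times> nat \<times> nat \<times> nat"
      assume x: "\<And>e. cmod (x e) \<le> 1" and y: "\<And>e. cmod (y e) \<le> 1"
        and xy: "\<And>e. cmod (x e - y e) \<le> r"
      have r: "0 \<le> r" using order_trans[OF norm_ge_zero xy] .
      obtain k j a b where e: "e = (k, j, a, b)" by (metis prod_cases4)
      show "cmod (T x e - T y e) \<le> r / 2"
      proof (cases "(k, j) \<in> R \<union> S")
        case True
        note RS = RS[OF True]
        \<comment> \<open>The minus sign in \<open>T\<close> reverses the order of the difference.
          One factor is changed at a time, and each change costs at most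
          \<open>r / 4\<close>.\<close>
        have "T y e - T x e = bilin (N k) (M j) (D k j) (\<lambda>n. w x k a n - w y k a n) (v x j b) +
            bilin (N k) (M j) (D k j) (w y k a) (\<lambda>m. v x j b m - v y j b m)"
          using True by (simp add: T_def e flip: bilin_diff)
        moreover have "cmod (bilin (N k) (M j) (D k j) (\<lambda>n. w x k a n - w y k a n) (v x j b)) \<le> r * 1 / 4"
          by (intro bilin_D' RS w_diff xy v_le x)
        moreover have "cmod (bilin (N k) (M j) (D k j) (w y k a) (\<lambda>m. v x j b m - v y j b m)) \<le> 1 * r / 4"
          by (intro bilin_D' RS v_diff xy w_le y)
        ultimately have "cmod (T y e - T x e) \<le> r / 2"
          by (intro order_trans[OF eq_refl[OF arg_cong[of _ _ cmod]] norm_triangle_le]) auto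
        then show ?thesis by (simp add: norm_minus_commute)
      qed (use r in \<open>simp add: T_def e\<close>)
    qed (rule that)
    define W where "W k = mat (d k) (N k) (\<lambda>(a, n). w x k a n)" for k
    define V where "V j = mat (M j) (d j) (\<lambda>(m, b). v x j b m)" for j
    have WHV: "(W k * mat (N k) (M j) (\<lambda>(n, m). H k j n m) * V j) $$ (a, b) =
        bilin (N k) (M j) (H k j) (w x k a) (v x j b)" if "a < d k" "b < d j" for k j a b
      unfolding W_def V_def
      using that by (rule index_mult_mult_mat[where f = "w x k" and g = "\<lambda>m b. v x j b m" and A = "H k j"])
    have WHV_carrier: "W k * mat (N k) (M j) (\<lambda>(n, m). H k j n m) * V j \<in> carrier_mat (d k) (d j)" for k j
      unfolding W_def V_def
      by (rule mult_carrier_mat[OF mult_carrier_mat[OF mat_carrier mat_carrier] mat_carrier])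
    have "W k * mat (N k) (M j) (\<lambda>(n, m). H k j n m) * V j = 0\<^sub>m (d k) (d j)"
      if kj: "(k, j) \<in> R \<union> S" for k j
    proof (rule eq_matI)
      fix a b assume "a < dim_row (0\<^sub>m (d k) (d j))" "b < dim_col (0\<^sub>m (d k) (d j))"
      then have ab: "a < d k" "b < d j" by simp_all
      have "bilin (N k) (M j) (D k j) (w x k a) (v x j b) = - x (k, j, a, b)"
        using fix_x[of "(k, j, a, b)"] kj by (simp add: T_def minus_equation_iff)
      then show "(W k * mat (N k) (M j) (\<lambda>(n, m). H k j n m) * V j) $$ (a, b) = 0\<^sub>m (d k) (d j) $$ (a, b)"
        using ab kj by (simp add: WHV bilin_H bilin_H0)
    qed (use WHV_carrier in \<open>auto simp: W_def V_def\<close>)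
    moreover have "det (W k * mat (N k) (M k) (\<lambda>(n, m). H k k n m) * V k) \<noteq> 0" if k: "k \<in> Rx" for k
    proof (rule det_nonzero_near_identity[OF WHV_carrier])
      fix a b assume ab: "a < d k" "b < d k"
      have "k \<in> Tx" using k sub(1) by auto
      have "(W k * mat (N k) (M k) (\<lambda>(n, m). H k k n m) * V k) $$ (a, b) - (if a = b then 1 else 0) =
          bilin (N k) (M k) (D k k) (w x k a) (v x k b)" (is "?d = ?b")
        using ab k by (simp add: WHV bilin_H bilin_H0_diag)
      then have "real (d k) * cmod ?d \<le> cmod ?b * real (d k + 1)"
        by (simp add: algebra_simps)
      also have "\<dots> \<le> 1 * 1 / 4"
        by (intro bilin_D k \<open>k \<in> Tx\<close> w_le v_le x)
      finally show "real (d k) * cmod ?d < 1" by simp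
    qed
    moreover have "V j $$ (m, b) = (if m = b then 1 else 0)" if "j \<in> Tx" "m < d j" "b < d j" for j m b
      using that dM[OF that(1)] by (simp add: V_def v_def)
    ultimately show "\<exists>W V. solves_alignment Rx Tx (R \<union> S) M N d (\<lambda>(k, j, n, m). H k j n m) W V"
      unfolding solves_alignment_def by (intro exI[of _ W] exI[of _ V]) (auto simp: W_def V_def)
  qed
qed

section \<open>Random channels\<close>

lemma alg_indep_restrict: "alg_indep I (restrict x I) \<longleftrightarrow> alg_indep I x"
proof -
  have "override_on c (restrict x I) I = override_on c x I" for c
    by (auto simp: override_on_def)
  then show ?thesis by (simp add: alg_indep_def)
qed

text \<open>Independence makes the joint distribution the product of the marginals, and for that
  product the claim is known.\<close>

lemma (in prob_space) AE_alg_indep_of_indep_vars: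
  fixes X :: "'v::countable \<Rightarrow> 'a \<Rightarrow> complex"
  assumes "finite I" "I \<noteq> {}" and indep: "indep_vars (\<lambda>_. borel) X I"
    and cont: "\<And>i. i \<in> I \<Longrightarrow> continuously_distributed M (X i)"
  shows "AE \<omega> in M. alg_indep I (\<lambda>i. X i \<omega>)"
proof -
  have X: "random_variable borel (X i)" if "i \<in> I" for i
    using cont[OF that] by (simp add: continuously_distributed_def)
  have "AE x in PiM I (\<lambda>i. distr M borel (X i)). alg_indep I x"
    using cont by (intro AE_alg_indep assms(1) prob_space_distr X)
      (auto simp: continuously_distributed_def)
  also have "PiM I (\<lambda>i. distr M borel (X i)) = distr M (PiM I (\<lambda>_. borel)) (\<lambda>\<omega>. \<lambda>i\<in>I. X i \<omega>)"
    using indep indep_vars_iff_distr_eq_PiM'[OF assms(2) X] by simp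
  finally have "AE \<omega> in M. alg_indep I (\<lambda>i\<in>I. X i \<omega>)"
    by (rule AE_distrD[rotated]) (use X in measurable)
  then show ?thesis by (simp add: alg_indep_restrict)
qed

text \<open>The first \<open>m\<close> entries of the product of \<open>A\<close> with
  \<open>v\<close> are those of \<open>v\<close> itself, so the kernel is trivial and the columns
  are independent.\<close>

lemma rank_identity_block:
  fixes A :: "complex mat"
  assumes A: "A \<in> carrier_mat n m" and "m \<le> n"
    and id: "\<And>i j. i < m \<Longrightarrow> j < m \<Longrightarrow> A $$ (i, j) = (if i = j then 1 else 0)"
  shows "vec_space.rank n A = m"
proof -
  interpret vec_space "TYPE(complex)" n .
  have distinct: "distinct (cols A)"
  proof (subst distinct_conv_nth, intro allI impI)
    fix i j assume "i < length (cols A)" "j < length (cols A)" "i \<noteq> j"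
    then have ij: "i < m" "j < m" "i \<noteq> j" using A by auto
    then have "col A i $ i \<noteq> col A j $ i" using A id assms(2) by auto
    then show "cols A ! i \<noteq> cols A ! j" using A ij by auto
  qed
  have "lin_indpt (set (cols A))"
  proof
    assume "lin_dep (set (cols A))"
    then obtain v where v: "v \<in> carrier_vec m" "v \<noteq> 0\<^sub>v m" "A *\<^sub>v v = 0\<^sub>v n"
      using lin_depE[OF A _ distinct] by blast
    have "v $ i = 0" if i: "i < m" for i
    proof -
      have "v $ i = (\<Sum>j<m. if i = j then v $ j else 0)" using i by simp
      also have "\<dots> = (\<Sum>j<m. A $$ (i, j) * v $ j)"
        by (rule sum.cong) (use id i in auto)
      also have "\<dots> = (A *\<^sub>v v) $ i"
        using A v(1) i assms(2) by (auto simp: scalar_prod_def atLeast0LessThan)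
      finally show ?thesis using v(3) i assms(2) by simp
    qed
    then have "v = 0\<^sub>v m" using v(1) by (intro eq_vecI) auto
    then show False using v(2) by simp
  qed
  then show ?thesis by (rule lin_indpt_full_rank[OF A distinct])
qed

lemma mat_adjoint_carrier:
  assumes "A \<in> carrier_mat n m"
  shows "mat_adjoint A \<in> carrier_mat m n"
  using assms by (auto simp: mat_adjoint_def mat_of_rows_def)

lemma mat_adjoint_adjoint: "mat_adjoint (mat_adjoint A) = A"
  by (rule eq_matI) (auto simp: mat_adjoint_def mat_of_rows_def)

text \<open>Some algebraically independent \<open>g\<close> near the decoupled channel has a
  solution. The isomorphism from \<open>g\<close> to \<open>h\<close>, extended to the entries of
  that solution, carries it to a solution for \<open>h\<close>.\<close>

lemma solvable_of_alg_indep: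
  fixes Rx Tx :: "nat set" and R S :: "(nat \<times> nat) set" and M N d :: "nat \<Rightarrow> nat"
    and h :: "nat \<times> nat \<times> nat \<times> nat \<Rightarrow> complex"
  assumes fin: "finite Rx" "finite Tx"
    and sub: "Rx \<subseteq> Tx" "R \<subseteq> Rx \<times> Tx" "S \<subseteq> Rx \<times> Tx" "R \<inter> S = {}"
    and off_diag: "\<And>k j. (k, j) \<in> R \<union> S \<Longrightarrow> k \<noteq> j"
    and budget_N: "\<And>k. k \<in> Rx \<Longrightarrow> (\<Sum>j | (k, j) \<in> R. d j) + d k \<le> N k"
    and budget_M: "\<And>j. j \<in> Tx \<Longrightarrow> (\<Sum>k | (k, j) \<in> S. d k) + d j \<le> M j"
    and indep: "alg_indep {(k, j, n, m). k \<in> Rx \<and> j \<in> Tx \<and> n < N k \<and> m < M j} h"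
  shows "\<exists>W V. solves_alignment Rx Tx (R \<union> S) M N d h W V"
proof -
  let ?I = "{(k, j, n, m). k \<in> Rx \<and> j \<in> Tx \<and> n < N k \<and> m < M j}"
  obtain H0 :: "nat \<Rightarrow> nat \<Rightarrow> nat \<Rightarrow> nat \<Rightarrow> complex" and \<epsilon> :: real where "\<epsilon> > 0" and solvable:
    "\<And>H. (\<And>k j n m. k \<in> Rx \<Longrightarrow> j \<in> Tx \<Longrightarrow> n < N k \<Longrightarrow> m < M j \<Longrightarrow>
        cmod (H k j n m - H0 k j n m) \<le> \<epsilon>) \<Longrightarrow>
      \<exists>W V. solves_alignment Rx Tx (R \<union> S) M N d (\<lambda>(k, j, n, m). H k j n m) W V"
    by (rule solvable_near_decoupled_channel[OF fin sub off_diag budget_N budget_M]) blast+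
  have "finite ?I"
  proof (rule finite_subset)
    show "?I \<subseteq> Rx \<times> Tx \<times> (\<Union>k\<in>Rx. {..<N k}) \<times> (\<Union>j\<in>Tx. {..<M j})" by auto
  qed (use fin in auto)
  then obtain g where g: "alg_indep ?I g" and
    near: "\<And>i. i \<in> ?I \<Longrightarrow> dist ((\<lambda>(k, j, n, m). H0 k j n m) i) (g i) < \<epsilon>"
    by (rule alg_indep_dense[OF _ \<open>\<epsilon> > 0\<close>, where c = "\<lambda>(k, j, n, m). H0 k j n m"])
      (rule that)
  have g_near: "cmod (g (k, j, n, m) - H0 k j n m) \<le> \<epsilon>"
    if "k \<in> Rx" "j \<in> Tx" "n < N k" "m < M j" for k j n m
    using near[of "(k, j, n, m)"] that by (simp add: dist_norm norm_minus_commute)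
  obtain W V :: "nat \<Rightarrow> complex mat" where
    W: "\<forall>k\<in>Rx. W k \<in> carrier_mat (d k) (N k)" and
    V: "\<forall>j\<in>Tx. V j \<in> carrier_mat (M j) (d j)" and
    det_nz: "\<forall>k\<in>Rx. det (W k * mat (N k) (M k) (\<lambda>(n, m). g (k, k, n, m)) * V k) \<noteq> 0" and
    id: "\<forall>j\<in>Tx. \<forall>m<d j. \<forall>b<d j. V j $$ (m, b) = (if m = b then 1 else 0)" and
    zf: "\<forall>(k, j)\<in>R \<union> S.
      W k * mat (N k) (M j) (\<lambda>(n, m). g (k, j, n, m)) * V j = 0\<^sub>m (d k) (d j)"
    by (rule exE[OF solvable[of "\<lambda>k j n m. g (k, j, n, m)", OF g_near]])
      (assumption | unfold solves_alignment_def prod.case, elim exE conjE, rule that)+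
  note W = bspec[OF W] and V = bspec[OF V] and det_nz = bspec[OF det_nz]
    and zf = bspec[OF zf, of "(k, j)" for k j, simplified prod.case]
  obtain G where G: "partial_field_iso G" "\<And>i. i \<in> ?I \<Longrightarrow> (g i, h i) \<in> G"
    by (rule partial_field_iso_alg_indep[OF g indep]) (rule that)
  \<comment> \<open>These finitely many matrix entries are the numbers that must be adjoined to the
    domain.\<close>
  define E where "E = (\<Union>k\<in>Rx. (\<lambda>an. W k $$ an) ` ({..<d k} \<times> {..<N k})) \<union>
    (\<Union>j\<in>Tx. (\<lambda>mb. V j $$ mb) ` ({..<M j} \<times> {..<d j}))"
  have "finite E" unfolding E_def using fin by auto
  obtain G' where G': "partial_field_iso G'" "G \<subseteq> G'" "\<And>e. e \<in> E \<Longrightarrow> \<exists>y. (e, y) \<in> G'"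
    using partial_field_iso.extend_finite[OF G(1) \<open>finite E\<close>] by blast
  interpret partial_field_iso G' by (rule G'(1))
  have "\<exists>A. mat_rel (W k) A" if k: "k \<in> Rx" for k
  proof -
    have "W k $$ (a, n) \<in> E" if "a < dim_row (W k)" "n < dim_col (W k)" for a n
      using W[OF k] k that unfolding E_def by (intro UnI1 UN_I[of k]) auto
    then show ?thesis using mat_rel_exists[of "W k"] G'(3) by metis
  qed
  then obtain W' where W': "\<And>k. k \<in> Rx \<Longrightarrow> mat_rel (W k) (W' k)" by metis
  have "\<exists>A. mat_rel (V j) A" if j: "j \<in> Tx" for j
  proof -
    have "V j $$ (m, b) \<in> E" if "m < dim_row (V j)" "b < dim_col (V j)" for m b
      using V[OF j] j that unfolding E_def by (intro UnI2 UN_I[of j]) auto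
    then show ?thesis using mat_rel_exists[of "V j"] G'(3) by metis
  qed
  then obtain V' where V': "\<And>j. j \<in> Tx \<Longrightarrow> mat_rel (V j) (V' j)" by metis
  have WHV: "mat_rel (W k * mat (N k) (M j) (\<lambda>(n, m). g (k, j, n, m)) * V j)
      (W' k * mat (N k) (M j) (\<lambda>(n, m). h (k, j, n, m)) * V' j)" if "k \<in> Rx" "j \<in> Tx" for k j
  proof (intro mat_rel_mult W' V' that)
    show "mat_rel (mat (N k) (M j) (\<lambda>(n, m). g (k, j, n, m))) (mat (N k) (M j) (\<lambda>(n, m). h (k, j, n, m)))"
      using that G(2) G'(2) by (auto simp: mat_rel_def)
  qed (use W[OF that(1)] V[OF that(2)] in auto)
  have "W' k \<in> carrier_mat (d k) (N k)" if "k \<in> Rx" for k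
    using W[OF that] W'[OF that] by (auto simp: mat_rel_def)
  moreover have V'_carrier: "V' j \<in> carrier_mat (M j) (d j)" if "j \<in> Tx" for j
    using V[OF that] V'[OF that] by (auto simp: mat_rel_def)
  moreover have "det (W' k * mat (N k) (M k) (\<lambda>(n, m). h (k, k, n, m)) * V' k) \<noteq> 0" if "k \<in> Rx" for k
    using det_nz[OF that] mat_rel_det[OF WHV] that sub(1) by blast
  moreover have "V' j $$ (m, b) = (if m = b then 1 else 0)" if j: "j \<in> Tx" and "m < d j" "b < d j" for j m b
  proof -
    have "d j \<le> M j" using budget_M[OF j] by simp
    then have "(V j $$ (m, b), V' j $$ (m, b)) \<in> G'"
      using V'[OF j] V[OF j] that by (auto simp: mat_rel_def)
    moreover have "(V j $$ (m, b), if m = b then 1 else 0) \<in> G'"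
      using id that one zero by auto
    \<comment> \<open>Two partners of one number agree because their difference is a partner of 0,
      and \<open>zero_iff\<close> makes it 0.\<close>
    ultimately have "(V j $$ (m, b) - V j $$ (m, b), V' j $$ (m, b) - (if m = b then 1 else 0)) \<in> G'"
      by (rule diff)
    then show ?thesis using zero_iff by fastforce
  qed
  moreover have "W' k * mat (N k) (M j) (\<lambda>(n, m). h (k, j, n, m)) * V' j = 0\<^sub>m (d k) (d j)"
    if "(k, j) \<in> R \<union> S" for k j
    using mat_rel_zero_mat[OF WHV zf[OF that]] that sub by blast
  ultimately show ?thesis
    unfolding solves_alignment_def by (intro exI[of _ W'] exI[of _ V']) auto
qed

theorem corollary3p1:
  fixes K J :: nat
    and M N d :: "nat \<Rightarrow> nat"
    and P :: "'a measure"
    and H :: "nat \<Rightarrow> nat \<Rightarrow> 'a \<Rightarrow> complex mat"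
    and \<A> :: "(nat \<times> nat) set"
  assumes "K \<ge> 1"
    and "\<And>j. j \<in> {1..K+J} \<Longrightarrow> M j > 0"
    and "\<And>j. j \<in> {1..K+J} \<Longrightarrow> d j > 0"
    and "\<And>k. k \<in> {1..K} \<Longrightarrow> N k > 0"
    and "prob_space P"
    and "\<And>k j \<omega>. k \<in> {1..K} \<Longrightarrow> j \<in> {1..K+J} \<Longrightarrow> \<omega> \<in> space P \<Longrightarrow>
           H k j \<omega> \<in> carrier_mat (N k) (M j)"
    and "prob_space.indep_vars P (\<lambda>_. borel) (\<lambda>(k, j, a, b) \<omega>. H k j \<omega> $$ (a, b))
           (entry_indices K J M N)"
    and "\<And>k j a b. (k, j, a, b) \<in> entry_indices K J M N \<Longrightarrow>
           continuously_distributed P (\<lambda>\<omega>. H k j \<omega> $$ (a, b))"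
    and "feasible_alignment_set K J M N d \<A>"
  shows "AE \<omega> in P. \<exists>U V :: nat \<Rightarrow> complex mat.
           (\<forall>k\<in>{1..K}. U k \<in> carrier_mat (N k) (d k)) \<and>
           (\<forall>j\<in>{1..K+J}. V j \<in> carrier_mat (M j) (d j)) \<and>
           (\<forall>k\<in>{1..K}. vec_space.rank (d k) (mat_adjoint (U k) * H k k \<omega> * V k) = d k) \<and>
           (\<forall>j\<in>{K+1..K+J}. vec_space.rank (M j) (V j) = d j) \<and>
           (\<forall>(k, j)\<in>\<A>. mat_adjoint (U k) * H k j \<omega> * V j = 0\<^sub>m (d k) (d j))"
proof -
  obtain At Ar :: "nat \<Rightarrow> (nat \<times> nat) set" where
    At: "\<And>j. j \<in> {1..K+J} \<Longrightarrow> At j \<subseteq> ({1..K} - {j}) \<times> {j}"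
      "\<And>j. j \<in> {1..K+J} \<Longrightarrow> (\<Sum>k | (k, j) \<in> At j. d k) + d j \<le> M j" and
    Ar: "\<And>k. k \<in> {1..K} \<Longrightarrow> Ar k \<subseteq> {(k, j) | j. j \<in> {1..K+J} - {k} \<and> (k, j) \<notin> At j}"
      "\<And>k. k \<in> {1..K} \<Longrightarrow> (\<Sum>j | (k, j) \<in> Ar k. d j) + d k \<le> N k" and
    A: "\<A> = (\<Union>k\<in>{1..K}. Ar k) \<union> (\<Union>j\<in>{1..K+J}. At j)"
    using assms(9) unfolding feasible_alignment_set_def by (elim exE conjE) (rule that, simp_all)
  let ?Rx = "{1..K}" and ?Tx = "{1..K+J}"
  define R where "R = (\<Union>k\<in>?Rx. Ar k)"
  define S where "S = (\<Union>j\<in>?Tx. At j)"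
  \<comment> \<open>\<open>Ar k\<close> contains only pairs with receiver \<open>k\<close>, and
    \<open>At j\<close> only pairs with transmitter \<open>j\<close>. The unions therefore mix
    nothing, and the budgets carry over to \<open>R\<close> and \<open>S\<close>.\<close>
  have R_iff: "(k, j) \<in> R \<longleftrightarrow> k \<in> ?Rx \<and> (k, j) \<in> Ar k" for k j
    unfolding R_def using Ar(1) by blast
  have S_iff: "(k, j) \<in> S \<longleftrightarrow> j \<in> ?Tx \<and> (k, j) \<in> At j" for k j
    unfolding S_def using At(1) by blast
  have sub: "R \<subseteq> ?Rx \<times> ?Tx" "S \<subseteq> ?Rx \<times> ?Tx" "R \<inter> S = {}"
  proof -
    show "R \<subseteq> ?Rx \<times> ?Tx" unfolding R_def using Ar(1) by blast
    show "S \<subseteq> ?Rx \<times> ?Tx" unfolding S_def using At(1) by blast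
    have False if "(k, j) \<in> R" "(k, j) \<in> S" for k j
      using that Ar(1)[of k] unfolding R_iff S_iff by blast
    then show "R \<inter> S = {}" by auto
  qed
  have off_diag: "k \<noteq> j" if "(k, j) \<in> R \<union> S" for k j
    using that Ar(1)[of k] At(1)[of j] unfolding Un_iff R_iff S_iff by blast
  have budget_N: "(\<Sum>j | (k, j) \<in> R. d j) + d k \<le> N k" if "k \<in> ?Rx" for k
    using Ar(2)[OF that] that by (simp add: R_iff)
  have budget_M: "(\<Sum>k | (k, j) \<in> S. d k) + d j \<le> M j" if "j \<in> ?Tx" for j
    using At(2)[OF that] that by (simp add: S_iff)
  define I where "I = entry_indices K J M N"
  have I: "I = {(k, j, n, m). k \<in> ?Rx \<and> j \<in> ?Tx \<and> n < N k \<and> m < M j}"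
    by (simp add: I_def entry_indices_def)
  have "finite I"
  proof (rule finite_subset)
    show "I \<subseteq> ?Rx \<times> ?Tx \<times> (\<Union>k\<in>?Rx. {..<N k}) \<times> (\<Union>j\<in>?Tx. {..<M j})"
      unfolding I by auto
  qed auto
  have "(1, 1, 0, 0) \<in> I"
    using assms(1) assms(2,4)[of 1] by (simp add: I)
  then have "I \<noteq> {}" by blast
  define X where "X = (\<lambda>(k, j, a, b) \<omega>. H k j \<omega> $$ (a, b))"
  interpret prob_space P by (rule assms(5))
  have "AE \<omega> in P. alg_indep I (\<lambda>i. X i \<omega>)"
  proof (rule AE_alg_indep_of_indep_vars[OF \<open>finite I\<close> \<open>I \<noteq> {}\<close>])
    show "indep_vars (\<lambda>_. borel) X I"
      using assms(7) by (simp add: X_def I_def)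
    show "continuously_distributed P (X i)" if "i \<in> I" for i
      using that assms(8) by (cases i) (auto simp: X_def I_def)
  qed
  then show ?thesis
  proof (rule AE_mp, intro AE_I2 impI)
    fix \<omega> assume \<omega>: "\<omega> \<in> space P" and indep: "alg_indep I (\<lambda>i. X i \<omega>)"
    obtain W V :: "nat \<Rightarrow> complex mat" where
      W: "\<forall>k\<in>?Rx. W k \<in> carrier_mat (d k) (N k)" and
      V: "\<forall>j\<in>?Tx. V j \<in> carrier_mat (M j) (d j)" and
      det_nz: "\<forall>k\<in>?Rx. det (W k * mat (N k) (M k) (\<lambda>(n, m). X (k, k, n, m) \<omega>) * V k) \<noteq> 0" and
      id: "\<forall>j\<in>?Tx. \<forall>m<d j. \<forall>b<d j. V j $$ (m, b) = (if m = b then 1 else 0)" and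
      zf: "\<forall>(k, j)\<in>R \<union> S.
        W k * mat (N k) (M j) (\<lambda>(n, m). X (k, j, n, m) \<omega>) * V j = 0\<^sub>m (d k) (d j)"
      using solvable_of_alg_indep[OF _ _ _ sub off_diag budget_N budget_M indep[unfolded I]]
      unfolding solves_alignment_def by auto
    have H: "mat (N k) (M j) (\<lambda>(n, m). X (k, j, n, m) \<omega>) = H k j \<omega>"
      if "k \<in> ?Rx" "j \<in> ?Tx" for k j
      using assms(6)[OF that \<omega>] by (intro eq_matI) (auto simp: X_def)
    have WHV: "W k * H k j \<omega> * V j \<in> carrier_mat (d k) (d j)" if "k \<in> ?Rx" "j \<in> ?Tx" for k j
      using W V that assms(6)[OF that \<omega>] by (meson mult_carrier_mat)
    have rank_direct: "vec_space.rank (d k) (W k * H k k \<omega> * V k) = d k" if k: "k \<in> ?Rx" for k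
    proof -
      have "k \<in> ?Tx" using k by simp
      then show ?thesis
        using vec_space.det_rank_iff[OF WHV[OF k]] bspec[OF det_nz k] H[OF k] by simp
    qed
    have rank_jammer: "vec_space.rank (M j) (V j) = d j" if "j \<in> {K+1..K+J}" for j
    proof -
      have j: "j \<in> ?Tx" using that by simp
      then show ?thesis
        using budget_M[OF j] V id by (intro rank_identity_block) auto
    qed
    have zero_forcing: "W k * H k j \<omega> * V j = 0\<^sub>m (d k) (d j)" if "(k, j) \<in> \<A>" for k j
    proof -
      have kj: "(k, j) \<in> R \<union> S" using that by (simp add: A R_def S_def)
      then have "k \<in> ?Rx" "j \<in> ?Tx" using sub by auto
      then show ?thesis using bspec[OF zf kj] H[of k j] by simp
    qed
    show "\<exists>U V :: nat \<Rightarrow> complex mat.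
           (\<forall>k\<in>{1..K}. U k \<in> carrier_mat (N k) (d k)) \<and>
           (\<forall>j\<in>{1..K+J}. V j \<in> carrier_mat (M j) (d j)) \<and>
           (\<forall>k\<in>{1..K}. vec_space.rank (d k) (mat_adjoint (U k) * H k k \<omega> * V k) = d k) \<and>
           (\<forall>j\<in>{K+1..K+J}. vec_space.rank (M j) (V j) = d j) \<and>
           (\<forall>(k, j)\<in>\<A>. mat_adjoint (U k) * H k j \<omega> * V j = 0\<^sub>m (d k) (d j))"
    \<comment> \<open>The receive filters are the Hermitian transposes of the \<open>W k\<close>;
      applying the transpose twice gives \<open>W k\<close> back.\<close>
    proof (rule exI[of _ "\<lambda>k. mat_adjoint (W k)"], rule exI[of _ V], intro conjI)
      show "\<forall>k\<in>?Rx. mat_adjoint (W k) \<in> carrier_mat (N k) (d k)"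
        using W mat_adjoint_carrier by blast
    qed (use V rank_direct rank_jammer zero_forcing in \<open>auto simp: mat_adjoint_adjoint\<close>)
  qed
qed

end
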